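(* Let $k,d$ be integers with $2\le k\le d-1$ and let $P$ and $Q$ be two convex polytopes in ${\mathbb E}^d$ containing the origin in their interior. Assume that for every $k$-dimensional linear subspace $H$ of ${\mathbb E}^d$ the sections $P\cap H$ and $Q\cap H$ are congruent. Then $P=Q$ or $P=-Q$.
   Context: ${\mathbb E}^d$ is $d$-dimensional Euclidean space. A convex polytope in ${\mathbb E}^d$ is a convex body (compact convex set with non-empty interior in ${\mathbb E}^d$) that is the convex hull of finitely many points. The sections $P\cap H$ and $Q\cap H$ are called congruent if there exists an orthogonal transformation $\varphi\in O(k,H)$ of $H$ (reflections allowed; $\varphi$ may depend on $H$) such that $\varphi(P\cap H)$ is a translate of $Q\cap H$ (by a vector of $H$). $-Q=\{-x: x\in Q\}$. *)

theory Defs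
  imports "HOL-Analysis.Analysis"
begin

definition convex_body :: "'a::euclidean_space set \<Rightarrow> bool" where
  "convex_body K \<longleftrightarrow> compact K \<and> convex K \<and> interior K \<noteq> {}"

(* The library predicate polytope (convex hull of a finite set) also admits
   lower-dimensional sets, so full-dimensionality is required separately. *)
definition convex_polytope :: "'a::euclidean_space set \<Rightarrow> bool" where
  "convex_polytope P \<longleftrightarrow> convex_body P \<and> polytope P"

(* The restriction of f to H is an element of O(H).  Nothing is required of f outside H.
   Since f is linear and isometric on the finite-dimensional subspace H and maps H into H,
   it is a bijection of H.  Both orientation-preserving and orientation-reversing maps are
   allowed. *)
definition orthogonal_transformation_on ::
    "'a::euclidean_space set \<Rightarrow> ('a \<Rightarrow> 'a) \<Rightarrow> bool" where
  "orthogonal_transformation_on H f \<longleftrightarrow>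
     f ` H \<subseteq> H \<and>
     (\<forall>x\<in>H. \<forall>y\<in>H. f (x + y) = f x + f y) \<and>
     (\<forall>c. \<forall>x\<in>H. f (c *\<^sub>R x) = c *\<^sub>R f x) \<and>
     (\<forall>x\<in>H. \<forall>y\<in>H. f x \<bullet> f y = x \<bullet> y)"

lemma orthogonal_transformation_on_UNIV:
  "orthogonal_transformation_on UNIV f \<longleftrightarrow> orthogonal_transformation f"
  by (auto simp: orthogonal_transformation_on_def orthogonal_transformation_def linear_iff)

definition congruent_in ::
    "'a::euclidean_space set \<Rightarrow> 'a set \<Rightarrow> 'a set \<Rightarrow> bool" where
  "congruent_in H A B \<longleftrightarrow>
     (\<exists>\<phi> t. orthogonal_transformation_on H \<phi> \<and> t \<in> H \<and> \<phi> ` A = (\<lambda>x. t + x) ` B)"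

end

theory Submission
  imports Defs
begin

text \<open>
  Fix a subspace \<open>W\<close> of dimension \<open>k + 1\<close> and cut \<open>P \<inter> W\<close> and \<open>Q \<inter> W\<close> by the hyperplanes
  \<open>n\<^sup>\<bottom>\<close>, \<open>n \<in> W\<close>. If no vertex lies on
  \<open>n\<^sup>\<bottom>\<close>, every extreme point of such a section is the intersection of
  \<open>n\<^sup>\<bottom>\<close> with a line through two vertices, hence a rational function of \<open>n\<close>. A congruence
  preserves the distances between extreme points, and for generic \<open>n\<close> an equality of two such distances
  is an identity of rational functions. Its poles recover the directions of the lines, and the leading
  coefficients at the poles recover the lines themselves up to sign, provided that not all lines met by
  the section are parallel; the sections then agree up to a reflection through the origin. Mixed
  signs would force two lines to span orthogonal planes for an open set of \<open>n\<close>, which contradicts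
  their transversality to \<open>n\<^sup>\<bottom>\<close>.

  Only parallel lines (a prism cut across its axis) need extra care: there the argument
  would only give sections that are congruent up to a translation. If \<open>P \<noteq> Q\<close>, then one polytope has a vertex
  \<open>p\<close> outside the other, and hyperplanes passing close to \<open>p\<close>, on a suitable side of it, meet
  two nonparallel edges. If also \<open>P \<noteq> -Q\<close>, choose \<open>W\<close> and such an \<open>n\<close> so that the section comes close to
  \<open>p\<close> and to a point witnessing \<open>P \<noteq> -Q\<close>: the two sections are then neither equal nor opposite.
\<close>

subsection \<open>Generic points for finitely many polynomial functions\<close>

lemma real_polynomial_function_inner_left [intro]:
  "real_polynomial_function (\<lambda>m::'a::real_inner. u \<bullet> m)"
  by (intro real_polynomial_function.intros(1) bounded_linear_inner_right)

text \<open>On the line through \<open>n\<close> and \<open>m\<close>, \<open>f\<close> is a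
  one-variable polynomial that is nonzero at parameter 1 and so has finitely many roots, whereas
  infinitely many parameters near 0 stay in \<open>U\<close>.\<close>

lemma real_polynomial_function_nonzero_near:
  fixes f :: "'a::real_normed_vector \<Rightarrow> real"
  assumes f: "real_polynomial_function f" and T: "subspace T"
    and m: "m \<in> T" "f m \<noteq> 0" and n: "n \<in> T" "n \<in> U" "open U"
  shows "\<exists>x\<in>U \<inter> T. f x \<noteq> 0"
proof -
  define g where "g = (\<lambda>t::real. n + t *\<^sub>R (m - n))"
  have "polynomial_function g"
    unfolding g_def
    by (intro polynomial_function_add polynomial_function_mult) auto
  then have "real_polynomial_function (f \<circ> g)"
    using f real_polynomial_function_compose by blast
  then obtain a N where fg: "f \<circ> g = (\<lambda>x. \<Sum>i\<le>N. a i * x ^ i)"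
    using real_polynomial_function_imp_sum by blast
  have "finite {t. (f \<circ> g) t = 0}"
  proof -
    have "(f \<circ> g) 1 \<noteq> 0" using m by (simp add: g_def)
    then have "\<not> (\<forall>i\<le>N. a i = 0)"
      unfolding fg by (metis (mono_tags, lifting) atMost_iff mult_zero_left sum.neutral)
    then show ?thesis
      unfolding fg using polyfun_finite_roots[of a N] by auto
  qed
  moreover have "infinite {t. g t \<in> U}"
  proof -
    have "continuous_on UNIV g" unfolding g_def by (intro continuous_intros)
    then have "open (g -` U)" using n(3) open_vimage by blast
    moreover have "0 \<in> g -` U" using n by (simp add: g_def)
    moreover have "g -` U = {t. g t \<in> U}" by auto
    ultimately show ?thesis
      using finite_imp_not_open by fastforce
  qed
  ultimately have "\<not> {t. g t \<in> U} \<subseteq> {t. (f \<circ> g) t = 0}"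
    using finite_subset by blast
  then obtain t where t: "g t \<in> U" "f (g t) \<noteq> 0"
    by auto
  have "g t \<in> T" unfolding g_def
    using T m n by (simp add: subspace_add subspace_diff subspace_scale)
  with t show ?thesis by blast
qed

text \<open>The form in which genericity is applied: at the chosen \<open>n\<close>, a zero of a
  member of \<open>F\<close> is never accidental but forces an identity on all of
  \<open>T\<close>.\<close>

lemma generic_point:
  fixes F :: "('a::real_normed_vector \<Rightarrow> real) set"
  assumes "finite F" and T: "subspace T" and "open U" and "U \<inter> T \<noteq> {}"
    and "\<And>f. f \<in> F \<Longrightarrow> real_polynomial_function f"
  shows "\<exists>n\<in>U \<inter> T. \<forall>f\<in>F. f n = 0 \<longrightarrow> (\<forall>m\<in>T. f m = 0)"
  using assms(1) assms(5)
proof (induction F rule: finite_induct)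
  case empty
  then show ?case using assms by auto
next
  case (insert f F)
  then obtain n where n: "n \<in> U \<inter> T" "\<forall>f\<in>F. f n = 0 \<longrightarrow> (\<forall>m\<in>T. f m = 0)" by auto
  show ?case
  proof (cases "\<forall>m\<in>T. f m = 0")
    case True
    then show ?thesis using n by auto
  next
    case False
    then obtain m where m: "m \<in> T" "f m \<noteq> 0" by auto
    \<comment> \<open>Shrinking \<open>U\<close> keeps the polynomials already treated nonzero while
      \<open>f\<close> is made nonzero.\<close>
    define U' where "U' = U \<inter> (\<Inter>g\<in>{g\<in>F. g n \<noteq> 0}. {x. g x \<noteq> 0})"
    have "open {x. g x \<noteq> 0}" if "g \<in> F" for g
    proof -
      have "continuous_on UNIV g"
        using insert.prems that continuous_on_polymonial_function real_polynomial_function_eq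
        by blast
      then show ?thesis
        by (intro open_Collect_neq) auto
    qed
    then have "open U'" unfolding U'_def
      using insert.hyps assms(3) by (intro open_Int open_INT) auto
    moreover have "n \<in> U'" using n by (auto simp: U'_def)
    ultimately obtain x where x: "x \<in> U' \<inter> T" "f x \<noteq> 0"
      using real_polynomial_function_nonzero_near[OF _ T m(1), of f n U'] m n insert.prems by blast
    have "x \<in> U \<inter> T" using x by (auto simp: U'_def)
    moreover have "\<forall>g\<in>F. g x = 0 \<longrightarrow> (\<forall>m\<in>T. g m = 0)"
      using x n by (auto simp: U'_def)
    ultimately show ?thesis using x by auto
  qed
qed

text \<open>At a point generic for both factors one of them vanishes, hence vanishes identically.
  This permits cancelling common factors on \<open>T\<close>.\<close>

lemma real_polynomial_functions_mult_eq_0: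
  fixes f g :: "'a::real_normed_vector \<Rightarrow> real"
  assumes "real_polynomial_function f" "real_polynomial_function g" and T: "subspace T"
    and "\<And>m. m \<in> T \<Longrightarrow> f m * g m = 0"
  shows "(\<forall>m\<in>T. f m = 0) \<or> (\<forall>m\<in>T. g m = 0)"
proof -
  obtain n where "n \<in> T" "\<forall>h\<in>{f, g}. h n = 0 \<longrightarrow> (\<forall>m\<in>T. h m = 0)"
    using generic_point[OF _ T open_UNIV, of "{f, g}"] assms(1,2) subspace_0[OF T] by auto
  moreover from this have "f n = 0 \<or> g n = 0" using assms(4)[of n] by simp
  ultimately show ?thesis by blast
qed

lemma in_span_singleton_iff: "u \<in> span {d} \<longleftrightarrow> (\<exists>c. u = c *\<^sub>R d)"
  by (auto simp: span_singleton)

lemma span_singleton_eq: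
  fixes u d :: "'a::real_vector"
  assumes "u \<in> span {d}" "u \<noteq> 0"
  shows "span {u} = span {d}"
proof -
  obtain c where c: "u = c *\<^sub>R d" "c \<noteq> 0" using assms by (auto simp: span_singleton)
  then have "d = (1/c) *\<^sub>R u" by simp
  then have "d \<in> span {u}" by (auto simp: span_singleton)
  with assms show ?thesis by (simp add: span_eq)
qed

text \<open>Supplies points of a pole \<open>d \<bullet> m = 0\<close> at which finitely many other
  linear forms are nonzero: a vector of \<open>W\<close> orthogonal to all of
  \<open>d\<^sup>\<bottom>\<close> in \<open>W\<close> is a multiple of \<open>d\<close>.\<close>

lemma generic_orthogonal:
  fixes d :: "'a::real_inner"
  assumes W: "subspace W" and d: "d \<in> W" and "finite U" and U: "U \<subseteq> W" "U \<inter> span {d} = {}"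
  shows "\<exists>n\<in>W. d \<bullet> n = 0 \<and> (\<forall>u\<in>U. u \<bullet> n \<noteq> 0)"
proof -
  define T where "T = W \<inter> {n. d \<bullet> n = 0}"
  have T: "subspace T" unfolding T_def
    by (intro subspace_inter W) (simp add: subspace_hyperplane)
  have "\<exists>n\<in>UNIV \<inter> T. \<forall>f\<in>(\<lambda>u m. u \<bullet> m) ` U. f n = 0 \<longrightarrow> (\<forall>m\<in>T. f m = 0)"
    using subspace_0[OF T] by (intro generic_point T finite_imageI assms(3)) auto
  then obtain n where n: "n \<in> T" "\<forall>f\<in>(\<lambda>u m. u \<bullet> m) ` U. f n = 0 \<longrightarrow> (\<forall>m\<in>T. f m = 0)"
    by blast
  have "u \<bullet> n \<noteq> 0" if u: "u \<in> U" for u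
  proof
    assume "u \<bullet> n = 0"
    then have z: "\<forall>m\<in>T. u \<bullet> m = 0" using n u by auto
    \<comment> \<open>The component of \<open>u\<close> orthogonal to \<open>d\<close>; for
      \<open>d = 0\<close> the quotient is 0 and \<open>m = u\<close>.\<close>
    define m where "m = u - ((u \<bullet> d) / (d \<bullet> d)) *\<^sub>R d"
    have "d \<bullet> m = 0" unfolding m_def by (cases "d = 0") (auto simp: inner_simps inner_commute)
    moreover have "m \<in> W" unfolding m_def
      using W d U u by (intro subspace_diff subspace_scale) auto
    ultimately have "m \<in> T" by (simp add: T_def)
    then have "m \<bullet> m = 0"
      using z \<open>d \<bullet> m = 0\<close> by (subst m_def) (simp add: inner_simps)
    then have "u = ((u \<bullet> d) / (d \<bullet> d)) *\<^sub>R d" by (simp add: m_def)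
    then have "u \<in> span {d}" using in_span_singleton_iff by blast
    then show False using U u by auto
  qed
  then show ?thesis using n by (auto simp: T_def)
qed

subsection \<open>Distances between points moving on lines\<close>

text \<open>
  \<open>line_cut q e n\<close> is the point where the line through \<open>q\<close> with direction \<open>e\<close> meets \<open>n\<^sup>\<bottom>\<close>; it is
  the junk value \<open>0\<close> if \<open>e \<bullet> n = 0\<close>. The function \<open>gap_diff\<close> is the difference of two squared distances
  between such points, with all denominators cleared.
\<close>

definition line_num :: "'a::real_inner \<Rightarrow> 'a \<Rightarrow> 'a \<Rightarrow> 'a" where
  "line_num q e m = (e \<bullet> m) *\<^sub>R q - (q \<bullet> m) *\<^sub>R e"

definition line_cut :: "'a::real_inner \<Rightarrow> 'a \<Rightarrow> 'a \<Rightarrow> 'a" where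
  "line_cut q e m = (1 / (e \<bullet> m)) *\<^sub>R line_num q e m"

text \<open>The squared distance of two cuts times the squares of both denominators, hence a
  polynomial in \<open>m\<close>.\<close>

definition gap :: "'a::real_inner \<Rightarrow> 'a \<Rightarrow> 'a \<Rightarrow> 'a \<Rightarrow> 'a \<Rightarrow> real" where
  "gap x d y e m = (norm ((e \<bullet> m) *\<^sub>R line_num x d m - (d \<bullet> m) *\<^sub>R line_num y e m))\<^sup>2"

definition gap_diff :: "'a::real_inner \<Rightarrow> 'a \<Rightarrow> 'a \<Rightarrow> 'a \<Rightarrow> 'a \<Rightarrow> 'a \<Rightarrow> 'a \<Rightarrow> 'a \<Rightarrow> 'a \<Rightarrow> real" where
  "gap_diff x d x' d' y e y' e' m =
     gap x d x' d' m * (e \<bullet> m)\<^sup>2 * (e' \<bullet> m)\<^sup>2 - gap y e y' e' m * (d \<bullet> m)\<^sup>2 * (d' \<bullet> m)\<^sup>2"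

lemma line_num_shift: "line_num (q - c *\<^sub>R e) e m = line_num q e m"
  by (simp add: line_num_def inner_simps algebra_simps)

lemma line_cut_eq: "e \<bullet> n \<noteq> 0 \<Longrightarrow> line_cut q e n = q - ((q \<bullet> n) / (e \<bullet> n)) *\<^sub>R e"
  by (simp add: line_cut_def line_num_def scaleR_diff_right)

text \<open>A cut point may replace the base point of its line. Thus the polynomials belonging to
  the extreme points of a section come from a finite list fixed before \<open>n\<close> is
  chosen.\<close>

lemma line_num_line_cut: "e \<bullet> n \<noteq> 0 \<Longrightarrow> line_num (line_cut q e n) e m = line_num q e m"
  by (simp add: line_cut_eq line_num_shift)

lemma line_num_perp: "x \<bullet> n = 0 \<Longrightarrow> line_num x e n = (e \<bullet> n) *\<^sub>R x"
  by (simp add: line_num_def)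

lemma line_num_scale: "line_num x (c *\<^sub>R d) m = c *\<^sub>R line_num x d m"
  by (simp add: line_num_def scaleR_diff_right mult.commute)

lemma line_num_parallel: "d \<bullet> m = 0 \<Longrightarrow> line_num x d m = - ((x \<bullet> m) *\<^sub>R d)"
  by (simp add: line_num_def)

lemma real_polynomial_function_line_num_inner:
  "real_polynomial_function (\<lambda>m. line_num x d m \<bullet> line_num y e m)"
  unfolding line_num_def inner_diff_left inner_diff_right inner_scaleR_left inner_scaleR_right
  by (intro real_polynomial_function_diff real_polynomial_function.intros(2-4)
        real_polynomial_function_inner_left)

lemma gap_expand:
  "gap x d y e m = (e \<bullet> m)\<^sup>2 * (line_num x d m \<bullet> line_num x d m)
     - 2 * (e \<bullet> m) * (d \<bullet> m) * (line_num x d m \<bullet> line_num y e m)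
     + (d \<bullet> m)\<^sup>2 * (line_num y e m \<bullet> line_num y e m)"
  unfolding gap_def power2_norm_eq_inner
  by (simp add: inner_simps algebra_simps power2_eq_square inner_commute[of "line_num y e m" "line_num x d m"])

lemma real_polynomial_function_gap: "real_polynomial_function (gap x d y e)"
  unfolding gap_expand[abs_def]
  by (intro real_polynomial_function_diff real_polynomial_function.intros(2-4)
        real_polynomial_function_inner_left real_polynomial_function_power
        real_polynomial_function_line_num_inner)

lemma real_polynomial_function_gap_diff: "real_polynomial_function (gap_diff x d x' d' y e y' e')"
  unfolding gap_diff_def[abs_def]
  by (intro real_polynomial_function_diff real_polynomial_function.intros(2-4)
        real_polynomial_function_inner_left real_polynomial_function_power
        real_polynomial_function_gap)

text \<open>For base points on \<open>n\<^sup>\<bottom>\<close> the cleared expression at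
  \<open>n\<close> contains their actual distance, so a congruence makes \<open>gap_diff\<close>
  vanish there.\<close>

lemma gap_perp:
  assumes "x \<bullet> n = 0" "y \<bullet> n = 0"
  shows "gap x d y e n = (d \<bullet> n)\<^sup>2 * (e \<bullet> n)\<^sup>2 * (norm (x - y))\<^sup>2"
proof -
  have "(e \<bullet> n) *\<^sub>R line_num x d n - (d \<bullet> n) *\<^sub>R line_num y e n = ((d \<bullet> n) * (e \<bullet> n)) *\<^sub>R (x - y)"
    using assms by (simp add: line_num_perp algebra_simps)
  then show ?thesis by (simp add: gap_def power_mult_distrib)
qed

text \<open>The first squared distance has a pole along \<open>d \<bullet> m = 0\<close>, so the second one must have it, too.\<close>

lemma gap_diff_direction:
  assumes W: "subspace W" and in_W: "x \<in> W" "x' \<in> W" "d \<in> W" "d' \<in> W" "e \<in> W" "e' \<in> W" "n \<in> W"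
    and perp: "x \<bullet> n = 0" "x' \<bullet> n = 0" and x: "x \<noteq> 0" "x \<noteq> x'"
    and trans: "d \<bullet> n \<noteq> 0" "d' \<bullet> n \<noteq> 0" "e \<bullet> n \<noteq> 0" "e' \<bullet> n \<noteq> 0"
    and zero: "\<And>m. m \<in> W \<Longrightarrow> gap_diff x d x' d' y e y' e' m = 0"
  shows "span {e} = span {d} \<or> span {e'} = span {d}"
proof (rule ccontr)
  assume "\<not> ?thesis"
  moreover have "e \<noteq> 0" "e' \<noteq> 0" "d' \<noteq> 0" using trans by auto
  ultimately have e: "e \<notin> span {d}" "e' \<notin> span {d}" using span_singleton_eq by blast+
  have nspan: "u \<notin> span {d}" if "u \<bullet> n = 0" "u \<noteq> 0" for u
    using that trans by (auto simp: span_singleton)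
  have dn: "norm d \<noteq> 0" using trans by auto
  show False
  proof (cases "d' \<in> span {d}")
    case False
    \<comment> \<open>On this pole the second term of \<open>gap_diff\<close> vanishes and the first
      does not. \<open>x\<close> is no multiple of \<open>d\<close>, because \<open>x\<close> is
      orthogonal to \<open>n\<close> and \<open>d\<close> is not.\<close>
    obtain m where m: "m \<in> W" "d \<bullet> m = 0" "\<forall>u\<in>{x, d', e, e'}. u \<bullet> m \<noteq> 0"
      using generic_orthogonal[OF W \<open>d \<in> W\<close>, of "{x, d', e, e'}"] e False nspan[of x] perp x in_W
      by auto
    have "gap x d x' d' m = (d' \<bullet> m)\<^sup>2 * (x \<bullet> m)\<^sup>2 * (norm d)\<^sup>2"
      unfolding gap_def using m(2) by (simp add: line_num_parallel power_mult_distrib)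
    then show False
      using zero[OF m(1)] m(2,3) dn by (simp add: gap_diff_def)
  next
    case True
    then obtain c where c: "d' = c *\<^sub>R d" "c \<noteq> 0"
      using \<open>d' \<noteq> 0\<close> by (auto simp: span_singleton)
    \<comment> \<open>For parallel lines \<open>c\<^sup>2 * (d \<bullet> m)\<^sup>2\<close> splits
      off; the quotient \<open>R\<close> still has a nonzero first term at suitable points of the
      pole, now governed by \<open>x - x'\<close>.\<close>
    define R where "R = (\<lambda>m. (norm (line_num (x - x') d m))\<^sup>2 * (e \<bullet> m)\<^sup>2 * (e' \<bullet> m)\<^sup>2
      - gap y e y' e' m * (d \<bullet> m)\<^sup>2)"
    have R: "gap_diff x d x' d' y e y' e' m = c\<^sup>2 * (d \<bullet> m)\<^sup>2 * R m" for m
    proof -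
      have "(d' \<bullet> m) *\<^sub>R line_num x d m - (d \<bullet> m) *\<^sub>R line_num x' d' m
          = (c * (d \<bullet> m)) *\<^sub>R line_num (x - x') d m"
        unfolding c line_num_def by (simp add: inner_simps algebra_simps)
      then have "gap x d x' d' m = c\<^sup>2 * (d \<bullet> m)\<^sup>2 * (norm (line_num (x - x') d m))\<^sup>2"
        by (simp add: gap_def power_mult_distrib)
      then show ?thesis
        unfolding gap_diff_def R_def c by (simp add: power_mult_distrib algebra_simps)
    qed
    have "real_polynomial_function R"
      unfolding R_def power2_norm_eq_inner
      by (intro real_polynomial_function_diff real_polynomial_function.intros(2-4)
        real_polynomial_function_inner_left real_polynomial_function_power
        real_polynomial_function_gap real_polynomial_function_line_num_inner)
    moreover have "real_polynomial_function (\<lambda>m. c\<^sup>2 * (d \<bullet> m)\<^sup>2)"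
      by (intro real_polynomial_function.intros(2-4)
        real_polynomial_function_inner_left real_polynomial_function_power)
    ultimately have Rz: "\<forall>m\<in>W. R m = 0"
      using real_polynomial_functions_mult_eq_0[of "\<lambda>m. c\<^sup>2 * (d \<bullet> m)\<^sup>2" R W] W zero R c trans(1) in_W(7)
      by auto
    have "x - x' \<notin> span {d}" using nspan[of "x - x'"] perp x by (simp add: inner_simps)
    then obtain m where m: "m \<in> W" "d \<bullet> m = 0" "\<forall>u\<in>{x - x', e, e'}. u \<bullet> m \<noteq> 0"
      using generic_orthogonal[OF W \<open>d \<in> W\<close>, of "{x - x', e, e'}"] e in_W W
      by (auto simp: subspace_diff)
    have "R m = ((x - x') \<bullet> m)\<^sup>2 * (norm d)\<^sup>2 * (e \<bullet> m)\<^sup>2 * (e' \<bullet> m)\<^sup>2"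
      unfolding R_def using m(2) by (simp add: line_num_parallel power_mult_distrib)
    then show False
      using Rz m dn by simp
  qed
qed

text \<open>Compares the leading coefficients at the common pole \<open>d \<bullet> m = 0\<close>.\<close>

lemma gap_diff_line:
  assumes W: "subspace W" and in_W: "x \<in> W" "y \<in> W" "d \<in> W" "d' \<in> W" "e' \<in> W" "n \<in> W"
    and perp: "x \<bullet> n = 0" "y \<bullet> n = 0"
    and trans: "d \<bullet> n \<noteq> 0"
    and dir: "e \<noteq> 0" "d' \<notin> span {d}" "e' \<notin> span {d}" "e \<in> span {d}"
    and zero: "\<And>m. m \<in> W \<Longrightarrow> gap_diff x d x' d' y e y' e' m = 0"
  shows "y = x \<or> y = - x"
proof -
  obtain c where c: "e = c *\<^sub>R d" "c \<noteq> 0" using dir by (auto simp: span_singleton)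
  \<comment> \<open>The quotient of \<open>gap_diff\<close> by
    \<open>c\<^sup>2 * (d \<bullet> m)\<^sup>2\<close>; on \<open>d \<bullet> m = 0\<close> it
    compares \<open>(x \<bullet> m)\<^sup>2\<close> with
    \<open>(y \<bullet> m)\<^sup>2\<close>.\<close>
  define R where "R = (\<lambda>m. gap x d x' d' m * (e' \<bullet> m)\<^sup>2 - gap y d y' e' m * (d' \<bullet> m)\<^sup>2)"
  have R: "gap_diff x d x' d' y e y' e' m = c\<^sup>2 * (d \<bullet> m)\<^sup>2 * R m" for m
  proof -
    have "(e' \<bullet> m) *\<^sub>R line_num y e m - (e \<bullet> m) *\<^sub>R line_num y' e' m
        = c *\<^sub>R ((e' \<bullet> m) *\<^sub>R line_num y d m - (d \<bullet> m) *\<^sub>R line_num y' e' m)"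
      unfolding c line_num_scale by (simp add: algebra_simps)
    then have "gap y e y' e' m = c\<^sup>2 * gap y d y' e' m"
      by (simp add: gap_def power_mult_distrib)
    then show ?thesis
      unfolding gap_diff_def R_def by (simp add: c power_mult_distrib algebra_simps)
  qed
  have "real_polynomial_function R"
    unfolding R_def
    by (intro real_polynomial_function_diff real_polynomial_function.intros(2-4)
      real_polynomial_function_inner_left real_polynomial_function_power
      real_polynomial_function_gap)
  moreover have "real_polynomial_function (\<lambda>m. c\<^sup>2 * (d \<bullet> m)\<^sup>2)"
    by (intro real_polynomial_function.intros(2-4)
      real_polynomial_function_inner_left real_polynomial_function_power)
  ultimately have Rz: "\<forall>m\<in>W. R m = 0"
    using real_polynomial_functions_mult_eq_0[of "\<lambda>m. c\<^sup>2 * (d \<bullet> m)\<^sup>2" R W] W zero R c trans in_W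
    by auto
  have nspan: "u \<notin> span {d}" if "u \<bullet> n = 0" "u \<noteq> 0" for u
    using that trans by (auto simp: span_singleton)
  show ?thesis
  proof (rule ccontr)
    assume "\<not> ?thesis"
    then have ne: "x - y \<noteq> 0" "x + y \<noteq> 0" by (auto simp: add_eq_0_iff)
    then have "x - y \<notin> span {d}" "x + y \<notin> span {d}"
      using nspan[of "x - y"] nspan[of "x + y"] perp by (simp_all add: inner_simps)
    then obtain m where m: "m \<in> W" "d \<bullet> m = 0" "\<forall>u\<in>{x - y, x + y, d', e'}. u \<bullet> m \<noteq> 0"
      using generic_orthogonal[OF W \<open>d \<in> W\<close>, of "{x - y, x + y, d', e'}"] dir in_W W
      by (auto simp: subspace_diff subspace_add)
    have "R m = (norm d)\<^sup>2 * (d' \<bullet> m)\<^sup>2 * (e' \<bullet> m)\<^sup>2 * (((x - y) \<bullet> m) * ((x + y) \<bullet> m))"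
      unfolding R_def gap_def using m(2)
      by (simp add: line_num_parallel power_mult_distrib inner_simps algebra_simps power2_eq_square)
    moreover have "norm d \<noteq> 0" using trans by auto
    ultimately show False using Rz m by simp
  qed
qed

text \<open>Testing the identity at \<open>n\<close>, \<open>n + t *\<^sub>R v'\<close>,
  \<open>n + t *\<^sub>R v\<close> and \<open>v + v'\<close> isolates first
  \<open>v \<bullet> v'\<close> and then the three products of the conclusion.\<close>

lemma line_num_inner_zero:
  assumes W: "subspace W" and in_W: "v \<in> W" "v' \<in> W" "n \<in> W"
    and perp: "v \<bullet> n = 0" "v' \<bullet> n = 0" and v: "v \<noteq> 0" "v' \<noteq> 0"
    and trans: "e \<bullet> n \<noteq> 0" "e' \<bullet> n \<noteq> 0"
    and zero: "\<And>m. m \<in> W \<Longrightarrow> line_num v e m \<bullet> line_num v' e' m = 0"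
  shows "v \<bullet> e' = 0" "e \<bullet> v' = 0" "e \<bullet> e' = 0"
proof -
  have vv: "v \<bullet> v' = 0"
    using zero[OF in_W(3)] perp trans by (simp add: line_num_perp)
  have eq: "(e \<bullet> m) * (v' \<bullet> m) * (v \<bullet> e') + (v \<bullet> m) * (e' \<bullet> m) * (e \<bullet> v')
      = (v \<bullet> m) * (v' \<bullet> m) * (e \<bullet> e')" if "m \<in> W" for m
    using zero[OF that] vv by (simp add: line_num_def inner_simps algebra_simps)
  \<comment> \<open>One of \<open>t = 1\<close> and \<open>t = -1\<close> works, since the two
    values add up to \<open>2 * (u \<bullet> n)\<close>.\<close>
  have nz: "\<exists>t. t \<noteq> 0 \<and> u \<bullet> n + t * (u \<bullet> w) \<noteq> 0" if "u \<bullet> n \<noteq> 0" for u w :: 'a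
  proof (cases "u \<bullet> n + 1 * (u \<bullet> w) = 0")
    case True
    then have "u \<bullet> n + (-1) * (u \<bullet> w) \<noteq> 0" using that by auto
    then show ?thesis by (intro exI[of _ "-1"]) auto
  qed (intro exI[of _ 1], auto)
  show a: "v \<bullet> e' = 0"
  proof -
    obtain t where t: "t \<noteq> 0" "e \<bullet> n + t * (e \<bullet> v') \<noteq> 0" using nz trans by blast
    have "n + t *\<^sub>R v' \<in> W" using in_W W by (simp add: subspace_add subspace_scale)
    from eq[OF this] show ?thesis using t v vv perp by (simp add: inner_simps)
  qed
  show b: "e \<bullet> v' = 0"
  proof -
    obtain t where t: "t \<noteq> 0" "e' \<bullet> n + t * (e' \<bullet> v) \<noteq> 0" using nz trans by blast
    have "n + t *\<^sub>R v \<in> W" using in_W W by (simp add: subspace_add subspace_scale)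
    from eq[OF this] show ?thesis using t v vv perp by (simp add: inner_simps inner_commute)
  qed
  have "v + v' \<in> W" using in_W W by (simp add: subspace_add)
  from eq[OF this] show "e \<bullet> e' = 0" using v vv a b by (simp add: inner_simps inner_commute)
qed

subsection \<open>Sections with nonparallel lines\<close>

text \<open>Two points could exchange their directions; a third excludes this. If \<open>E x\<close>
  differs from \<open>D x\<close>, every other \<open>y\<close> has \<open>E y = D x\<close> and
  \<open>D y = E x\<close>, and two such points violate the assumption between themselves.\<close>

lemma pair_matching:
  assumes "card X \<ge> 3"
    and pairs: "\<And>x x'. x \<in> X \<Longrightarrow> x' \<in> X \<Longrightarrow> x \<noteq> x' \<Longrightarrow>
      (E x = D x \<or> E x' = D x) \<and> (D x = E x \<or> D x' = E x)"
    and "x \<in> X"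
  shows "E x = D x"
proof (rule ccontr)
  assume ne: "E x \<noteq> D x"
  have "\<not> X \<subseteq> {x}" using assms(1) card_mono[of "{x}" X] by auto
  then obtain y where y: "y \<in> X" "y \<noteq> x" by blast
  have "\<not> X \<subseteq> {x, y}" using assms(1) card_mono[of "{x, y}" X] y by auto
  then obtain z where z: "z \<in> X" "z \<noteq> x" "z \<noteq> y" by blast
  show False
    using pairs[OF assms(3) y(1)] pairs[OF assms(3) z(1)] pairs[OF y(1) z(1)] y(2) z(2,3) ne by metis
qed

text \<open>Serves to exclude mixed signs. The projections \<open>h\<close>, \<open>h'\<close> of
  \<open>d\<close>, \<open>d'\<close> to \<open>n\<^sup>\<bottom>\<close> are orthogonal, since
  \<open>h\<close> lies in \<open>span S\<close> and \<open>h'\<close> is orthogonal to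
  \<open>S\<close>. So \<open>d \<bullet> d'\<close> reduces to
  \<open>(d \<bullet> n) * (d' \<bullet> n) / (n \<bullet> n)\<close>.\<close>

lemma orthogonal_parts_not_transversal:
  fixes S S' :: "'a::euclidean_space set"
  assumes W: "subspace W" and n: "n \<in> W" and span: "span (S \<union> S') = W \<inter> {m. n \<bullet> m = 0}"
    and orth: "\<And>x x'. x \<in> S \<Longrightarrow> x' \<in> S' \<Longrightarrow> x \<bullet> x' = 0"
    and d: "d \<in> W" "\<And>x'. x' \<in> S' \<Longrightarrow> d \<bullet> x' = 0"
    and d': "d' \<in> W" "\<And>x. x \<in> S \<Longrightarrow> d' \<bullet> x = 0"
    and "d \<bullet> d' = 0"
  shows "d \<bullet> n = 0 \<or> d' \<bullet> n = 0"
proof (cases "n = 0")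
  case False
  define h where "h = d - ((d \<bullet> n) / (n \<bullet> n)) *\<^sub>R n"
  define h' where "h' = d' - ((d' \<bullet> n) / (n \<bullet> n)) *\<^sub>R n"
  have hn: "n \<bullet> h = 0" "n \<bullet> h' = 0"
    unfolding h_def h'_def using False by (simp_all add: inner_simps inner_commute)
  have "h \<in> W" using W n d by (simp add: h_def subspace_diff subspace_scale)
  then have "h \<in> span (S \<union> S')" using span hn by simp
  then obtain a b where ab: "h = a + b" "a \<in> span S" "b \<in> span S'"
    unfolding span_Un by blast
  have xn: "n \<bullet> x = 0" if "x \<in> S \<union> S'" for x
    using span span_base[OF that] by auto
  have "orthogonal h b"
    using ab(3) by (intro orthogonal_to_span[of b S'])
      (auto simp: orthogonal_def h_def inner_simps d xn)
  moreover have "orthogonal a b"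
  proof -
    have "orthogonal x b" if "x \<in> S" for x
      using ab(3) that orth by (intro orthogonal_to_span[of b S']) (auto simp: orthogonal_def)
    then have "orthogonal b a"
      using ab(2) by (intro orthogonal_to_span[of a S]) (auto simp: orthogonal_commute)
    then show ?thesis by (simp add: orthogonal_commute)
  qed
  ultimately have "b \<bullet> b = 0" using ab(1) by (simp add: orthogonal_def inner_simps)
  then have "h \<in> span S" using ab by simp
  then have "orthogonal h' h"
    by (intro orthogonal_to_span[of h S]) (auto simp: orthogonal_def h'_def inner_simps d' xn)
  then have "h \<bullet> h' = 0" by (simp add: orthogonal_def inner_commute)
  moreover have "d = h + ((d \<bullet> n) / (n \<bullet> n)) *\<^sub>R n" "d' = h' + ((d' \<bullet> n) / (n \<bullet> n)) *\<^sub>R n"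
    by (simp_all add: h_def h'_def)
  then have "d \<bullet> d' = h \<bullet> h' + (d \<bullet> n) * (d' \<bullet> n) / (n \<bullet> n)"
    using hn False by (metis (no_types, lifting) add.right_neutral add_0 inner_add_left inner_add_right
      inner_commute inner_eq_zero_iff inner_scaleR_left inner_scaleR_right mult.assoc mult_zero_right
      nonzero_mult_div_cancel_right times_divide_eq_left times_divide_eq_right)
  ultimately show ?thesis using assms(9) False by simp
qed simp

text \<open>\<open>X\<close> and \<open>Y\<close> stand for the extreme points of two sections,
  \<open>D\<close> and \<open>E\<close> for the directions of the lines cutting them out;
  \<open>gen1\<close> and \<open>gen2\<close> express that \<open>n\<close> is generic. Directions
  are matched first, then points up to sign, and finally mixed signs are excluded.\<close>

lemma transversal_points_congruent:
  fixes X Y :: "'a::euclidean_space set"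
  assumes W: "subspace W" and n: "n \<in> W"
    and card: "card X \<ge> 3" and span: "span X = W \<inter> {m. n \<bullet> m = 0}"
    and Y: "Y \<subseteq> W \<inter> {m. n \<bullet> m = 0}" and nz: "0 \<notin> X" "0 \<notin> Y"
    and \<sigma>: "bij_betw \<sigma> X Y" "\<And>x x'. x \<in> X \<Longrightarrow> x' \<in> X \<Longrightarrow> norm (\<sigma> x - \<sigma> x') = norm (x - x')"
    and D: "\<And>x. x \<in> X \<Longrightarrow> D x \<in> W \<and> D x \<bullet> n \<noteq> 0"
    and E: "\<And>y. y \<in> Y \<Longrightarrow> E y \<in> W \<and> E y \<bullet> n \<noteq> 0"
    and gen1: "\<And>x x' y y' m. x \<in> X \<Longrightarrow> x' \<in> X \<Longrightarrow> y \<in> Y \<Longrightarrow> y' \<in> Y \<Longrightarrow> m \<in> W \<Longrightarrow>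
        gap_diff x (D x) x' (D x') y (E y) y' (E y') n = 0 \<Longrightarrow>
        gap_diff x (D x) x' (D x') y (E y) y' (E y') m = 0"
    and gen2: "\<And>x x' m. x \<in> X \<Longrightarrow> x' \<in> X \<Longrightarrow> m \<in> W \<Longrightarrow>
        line_num x (D x) n \<bullet> line_num x' (D x') n = 0 \<Longrightarrow>
        line_num x (D x) m \<bullet> line_num x' (D x') m = 0"
    and nonpar: "\<exists>x\<in>X. \<exists>x'\<in>X. span {D x} \<noteq> span {D x'}"
  shows "Y = X \<or> Y = uminus ` X"
proof -
  have XW: "x \<in> W" "x \<bullet> n = 0" if "x \<in> X" for x
    using span span_base[OF that] by (auto simp: inner_commute)
  have YW: "y \<in> W" "y \<bullet> n = 0" if "y \<in> Y" for y
    using Y that by (auto simp: inner_commute)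
  have \<sigma>Y: "\<sigma> x \<in> Y" if "x \<in> X" for x using \<sigma>(1) that by (meson bij_betwE)
  have \<sigma>inj: "\<sigma> x \<noteq> \<sigma> x'" if "x \<in> X" "x' \<in> X" "x \<noteq> x'" for x x'
    using \<sigma>(1) that by (auto simp: bij_betw_def inj_on_def)
  have gd: "gap_diff x (D x) x' (D x') (\<sigma> x) (E (\<sigma> x)) (\<sigma> x') (E (\<sigma> x')) m = 0"
    if "x \<in> X" "x' \<in> X" "m \<in> W" for x x' m
    by (rule gen1[OF that(1,2) \<sigma>Y[OF that(1)] \<sigma>Y[OF that(2)] that(3)])
      (use that \<sigma>(2)[of x x'] XW YW[OF \<sigma>Y] in \<open>simp add: gap_diff_def gap_perp\<close>)
  \<comment> \<open>Exchanging the two sections gives the second half of the hypothesis of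
    \<open>pair_matching\<close>.\<close>
  have gd': "gap_diff y (E y) y' (E y') x (D x) x' (D x') m = 0"
    if "x \<in> X" "x' \<in> X" "m \<in> W" "y = \<sigma> x" "y' = \<sigma> x'" for x x' y y' m
    using gd[OF that(1-3)] that(4,5) by (simp add: gap_diff_def)
  have pair: "span {E (\<sigma> x)} = span {D x} \<or> span {E (\<sigma> x')} = span {D x}"
       "span {D x} = span {E (\<sigma> x)} \<or> span {D x'} = span {E (\<sigma> x)}"
    if "x \<in> X" "x' \<in> X" "x \<noteq> x'" for x x'
  proof -
    note in_X = that(1,2) \<sigma>Y[OF that(1)] \<sigma>Y[OF that(2)]
    show "span {E (\<sigma> x)} = span {D x} \<or> span {E (\<sigma> x')} = span {D x}"
      by (rule gap_diff_direction[OF W _ _ _ _ _ _ n _ _ _ that(3) _ _ _ _ gd[OF that(1,2)]])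
        (use XW YW D E in_X nz in auto)
    show "span {D x} = span {E (\<sigma> x)} \<or> span {D x'} = span {E (\<sigma> x)}"
      by (rule gap_diff_direction[OF W _ _ _ _ _ _ n _ _ _ \<sigma>inj[OF that] _ _ _ _
            gd'[OF that(1,2) _ refl refl]])
        (use XW YW D E in_X nz in auto)
  qed
  have dir: "span {E (\<sigma> x)} = span {D x}" if "x \<in> X" for x
    using pair_matching[OF card, of "\<lambda>x. span {E (\<sigma> x)}" "\<lambda>x. span {D x}" x] pair that by blast
  have sgn: "\<sigma> x = x \<or> \<sigma> x = - x" if x: "x \<in> X" for x
  proof -
    \<comment> \<open>A partner with another direction makes the pole reveal \<open>x\<close>
      itself; a parallel partner would reveal only the difference \<open>x - x'\<close>.\<close>
    obtain x' where x': "x' \<in> X" "span {D x'} \<noteq> span {D x}"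
      using nonpar by metis
    have "D x \<noteq> 0" "D x' \<noteq> 0" "E (\<sigma> x) \<noteq> 0" "E (\<sigma> x') \<noteq> 0"
      using D E \<sigma>Y x x' by fastforce+
    then show ?thesis
      using x x' dir[OF x] dir[OF x'(1)] XW YW D E \<sigma>Y
      by (intro gap_diff_line[OF W _ _ _ _ _ n _ _ _ _ _ _ _ gd[OF x x'(1)]])
        (auto dest: span_singleton_eq simp: span_base)
  qed
  define S where "S = {x \<in> X. \<sigma> x = x}"
  define S' where "S' = {x \<in> X. \<sigma> x = - x}"
  have SS: "X = S \<union> S'" using sgn by (auto simp: S_def S'_def)
  have Yimg: "Y = \<sigma> ` X" using \<sigma>(1) by (simp add: bij_betw_def)
  have "S = {} \<or> S' = {}"
  proof (rule ccontr)
    assume "\<not> ?thesis"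
    then obtain a b where ab: "a \<in> S" "b \<in> S'" by blast
    \<comment> \<open>For opposite signs, equality of distances means orthogonality; by
      \<open>gen2\<close> this becomes an identity in \<open>m\<close> and so passes to the
      directions.\<close>
    have orth: "x \<bullet> x' = 0" if "x \<in> S" "x' \<in> S'" for x x'
    proof -
      have "norm (x + x') = norm (x - x')"
        using \<sigma>(2)[of x x'] that by (simp add: S_def S'_def)
      then have "(norm (x + x'))\<^sup>2 = (norm (x - x'))\<^sup>2" by simp
      then show ?thesis by (simp add: power2_norm_eq_inner inner_simps inner_commute)
    qed
    have z: "line_num x (D x) m \<bullet> line_num x' (D x') m = 0"
      if "x \<in> S" "x' \<in> S'" "m \<in> W" for x x' m
      by (rule gen2) (use that orth[OF that(1,2)] XW SS in \<open>auto simp: line_num_perp\<close>)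
    have perp: "x \<bullet> D x' = 0 \<and> D x \<bullet> x' = 0 \<and> D x \<bullet> D x' = 0"
      if xx: "x \<in> S" "x' \<in> S'" for x x'
    proof -
      have X: "x \<in> X" "x' \<in> X" using xx SS by auto
      note r = line_num_inner_zero[OF W XW(1)[OF X(1)] XW(1)[OF X(2)] n XW(2)[OF X(1)] XW(2)[OF X(2)]
          _ _ _ _ z[OF xx]]
      show ?thesis using r nz X D by blast
    qed
    have "D a \<bullet> n = 0 \<or> D b \<bullet> n = 0"
      by (rule orthogonal_parts_not_transversal[OF W n, of S S'])
        (use span SS orth perp ab D in \<open>auto simp: inner_commute\<close>)
    then show False using ab D SS by auto
  qed
  then show ?thesis
  proof
    assume "S' = {}"
    then have "\<forall>x\<in>X. \<sigma> x = x" using SS by (auto simp: S_def)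
    then show ?thesis using Yimg by simp
  next
    assume "S = {}"
    then have "\<forall>x\<in>X. \<sigma> x = - x" using SS by (auto simp: S'_def)
    then have "\<sigma> ` X = uminus ` X" by (intro image_cong) auto
    then show ?thesis using Yimg by simp
  qed
qed

subsection \<open>Extreme points of hyperplane sections\<close>

definition slice :: "'a::real_inner set \<Rightarrow> 'a \<Rightarrow> 'a set" where
  "slice K n = K \<inter> {m. n \<bullet> m = 0}"

lemma convex_slice: "convex K \<Longrightarrow> convex (slice K n)"
  unfolding slice_def by (intro convex_Int convex_hyperplane)

lemma compact_slice:
  fixes K :: "'a::euclidean_space set"
  shows "compact K \<Longrightarrow> compact (slice K n)"
  unfolding slice_def by (intro compact_Int_closed closed_hyperplane)

lemma line_cut_convex_comb:
  assumes "y \<bullet> n \<noteq> y' \<bullet> n"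
  defines "t \<equiv> - (y' \<bullet> n) / ((y - y') \<bullet> n)"
  shows "line_cut y' (y - y') n = (1 - t) *\<^sub>R y' + t *\<^sub>R y"
proof -
  have "(y - y') \<bullet> n \<noteq> 0" using assms by (simp add: inner_simps)
  then show "line_cut y' (y - y') n = (1 - t) *\<^sub>R y' + t *\<^sub>R y"
    by (simp add: line_cut_eq t_def algebra_simps)
qed

lemma line_cut_in_open_segment:
  assumes "y \<bullet> n > 0" "y' \<bullet> n < 0"
  obtains t where "0 < t" "t < 1" "line_cut y' (y - y') n = (1 - t) *\<^sub>R y' + t *\<^sub>R y"
proof
  define t where "t = - (y' \<bullet> n) / ((y - y') \<bullet> n)"
  show "0 < t" "t < 1" using assms by (simp_all add: t_def inner_simps field_simps)
  show "line_cut y' (y - y') n = (1 - t) *\<^sub>R y' + t *\<^sub>R y"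
    unfolding t_def using assms by (intro line_cut_convex_comb) auto
qed

lemma line_cut_perp: "n \<bullet> line_cut q e n = 0"
  by (simp add: line_cut_def line_num_def inner_diff_right inner_commute)

lemma line_cut_mem_slice:
  assumes "convex K" "y \<in> K" "y' \<in> K" "y \<bullet> n \<ge> 0" "y' \<bullet> n \<le> 0" "y \<bullet> n \<noteq> y' \<bullet> n"
  shows "line_cut y' (y - y') n \<in> slice K n"
proof -
  define t where "t = - (y' \<bullet> n) / ((y - y') \<bullet> n)"
  have "0 \<le> t" "t \<le> 1" using assms by (simp_all add: t_def inner_simps field_simps)
  moreover have "line_cut y' (y - y') n = (1 - t) *\<^sub>R y' + t *\<^sub>R y"
    unfolding t_def using assms by (intro line_cut_convex_comb) auto
  ultimately have "line_cut y' (y - y') n \<in> K"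
    using assms by (simp add: convex_alt)
  then show ?thesis using line_cut_perp by (simp add: slice_def)
qed

lemma line_cut_endpoint:
  assumes "y \<bullet> n \<noteq> y' \<bullet> n"
  shows "y \<bullet> n = 0 \<Longrightarrow> line_cut y' (y - y') n = y" "y' \<bullet> n = 0 \<Longrightarrow> line_cut y' (y - y') n = y'"
  using assms by (simp_all add: line_cut_eq inner_simps)

text \<open>If a convex combination giving \<open>x\<close> has weight on the positive side, it has
  weight on the negative side, too. A multiple of the crossing point \<open>f\<close> then splits
  off, and extremality forces \<open>x = f\<close>. Otherwise all weight sits on the hyperplane, and
  \<open>x\<close> is extreme in the hull of the points of \<open>V\<close> there.\<close>

lemma extreme_point_of_slice_hull:
  fixes V :: "'a::euclidean_space set"
  assumes V: "finite V" and x: "x extreme_point_of slice (convex hull V) n"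
  shows "x \<in> V \<or> (\<exists>y\<in>V. \<exists>y'\<in>V. y \<bullet> n > 0 \<and> y' \<bullet> n < 0 \<and> x = line_cut y' (y - y') n)"
proof -
  have xS: "x \<in> slice (convex hull V) n" using x by (simp add: extreme_point_of_def)
  then obtain u where u: "\<And>v. v \<in> V \<Longrightarrow> 0 \<le> u v" "sum u V = 1" "(\<Sum>v\<in>V. u v *\<^sub>R v) = x"
    using V by (auto simp: slice_def convex_hull_finite)
  have "(\<Sum>v\<in>V. u v *\<^sub>R v) \<bullet> n = 0" using xS u by (simp add: slice_def inner_commute)
  then have un: "(\<Sum>v\<in>V. u v * (v \<bullet> n)) = 0" by (simp add: inner_sum_left)
  show ?thesis
  proof (cases "\<exists>y\<in>V. u y \<noteq> 0 \<and> y \<bullet> n > 0")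
    case True
    then obtain y where y: "y \<in> V" "u y > 0" "y \<bullet> n > 0" using u(1) by force
    have "\<exists>y'\<in>V. u y' * (y' \<bullet> n) < 0"
    proof (rule ccontr)
      assume "\<not> ?thesis"
      then have nn: "0 \<le> u v * (v \<bullet> n)" if "v \<in> V" for v
        using that by (meson not_less)
      have "\<forall>v\<in>V. u v * (v \<bullet> n) = 0"
        using sum_nonneg_eq_0_iff[of V "\<lambda>v. u v * (v \<bullet> n)", OF V nn] un by simp
      then have "u y * (y \<bullet> n) = 0" using y(1) by (rule bspec)
      then show False using y by simp
    qed
    then obtain y' where y': "y' \<in> V" "u y' > 0" "y' \<bullet> n < 0"
      using u(1) by (metis linorder_neqE_linordered_idom mult_eq_0_iff mult_nonneg_nonneg not_less order_le_less)
    define f where "f = line_cut y' (y - y') n"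
    obtain t where t: "0 < t" "t < 1" "f = (1 - t) *\<^sub>R y' + t *\<^sub>R y"
      using line_cut_in_open_segment[OF y(3) y'(3)] unfolding f_def by blast
    have yy: "y \<noteq> y'" using y y' by auto
    \<comment> \<open>The minimum keeps the remaining weights nonnegative; halving it gives
      \<open>\<mu> < 1\<close>, so that the remainder can be renormalised.\<close>
    define \<mu> where "\<mu> = min (u y) (u y') / 2"
    have "u y \<le> sum u V" using y V u by (intro member_le_sum) auto
    then have \<mu>: "0 < \<mu>" "\<mu> < 1" "\<mu> \<le> u y" "\<mu> \<le> u y'" using y y' u by (auto simp: \<mu>_def)
    define w where "w = (\<lambda>v. (u v - \<mu> * ((if v = y then t else 0) + (if v = y' then 1 - t else 0))) / (1 - \<mu>))"
    define z where "z = (\<Sum>v\<in>V. w v *\<^sub>R v)"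
    have w0: "0 \<le> w v" if "v \<in> V" for v
    proof -
      have "\<mu> * t \<le> u y" "\<mu> * (1 - t) \<le> u y'"
        using \<mu> t mult_left_le[of t \<mu>] mult_left_le[of "1 - t" \<mu>] by linarith+
      then show ?thesis using u(1)[OF that] \<mu> yy by (auto simp: w_def)
    qed
    have ite: "(\<Sum>v\<in>V. (if v = y then t else 0) + (if v = y' then 1 - t else 0)) = 1"
      using V y y' by (simp add: sum.distrib)
    have "sum w V = (sum u V - \<mu> * (\<Sum>v\<in>V. (if v = y then t else 0) + (if v = y' then 1 - t else 0)))
        / (1 - \<mu>)"
      unfolding w_def by (simp only: sum_divide_distrib[symmetric] sum_subtractf sum_distrib_left)
    then have w1: "sum w V = 1" using \<mu> u ite by simp
    have "z = (1 / (1 - \<mu>)) *\<^sub>R (x - \<mu> *\<^sub>R f)"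
    proof -
      have fs: "(\<Sum>v\<in>V. ((if v = y then t else 0) + (if v = y' then 1 - t else 0)) *\<^sub>R v) = f"
        using V y y' t by (simp add: scaleR_left_distrib sum.distrib if_distrib[of "\<lambda>c. c *\<^sub>R _"] cong: if_cong)
      have "x - \<mu> *\<^sub>R f = (\<Sum>v\<in>V. (u v - \<mu> * ((if v = y then t else 0) + (if v = y' then 1 - t else 0))) *\<^sub>R v)"
        unfolding u(3)[symmetric] fs[symmetric]
        by (simp only: scaleR_left_diff_distrib sum_subtractf scaleR_sum_right scaleR_scaleR)
      then show ?thesis
        unfolding z_def w_def by (simp add: scaleR_sum_right)
    qed
    then have xz: "x = (1 - \<mu>) *\<^sub>R z + \<mu> *\<^sub>R f" using \<mu> by simp
    have fS: "f \<in> slice (convex hull V) n"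
      unfolding f_def using y y' by (intro line_cut_mem_slice) (auto intro: hull_inc)
    have "z \<in> convex hull V"
      using w0 w1 V by (auto simp: convex_hull_finite z_def)
    moreover have "n \<bullet> z = 0"
    proof -
      have "n \<bullet> x = (1 - \<mu>) * (n \<bullet> z) + \<mu> * (n \<bullet> f)" unfolding xz by (simp add: inner_simps)
      then show ?thesis using xS fS \<mu> by (simp add: slice_def)
    qed
    ultimately have zS: "z \<in> slice (convex hull V) n" by (simp add: slice_def)
    have "z = f"
    proof (rule ccontr)
      assume "z \<noteq> f"
      then have "x \<in> open_segment z f" using xz \<mu> by (auto simp: in_segment)
      then show False using x zS fS by (simp add: extreme_point_of_def)
    qed
    then have "x = f" using xz by (simp add: algebra_simps)
    then show ?thesis using y y' f_def by blast
  next
    case False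
    have "\<forall>v\<in>V. 0 \<le> - (u v * (v \<bullet> n))"
      using False u(1) by (force simp: mult_le_0_iff)
    then have "\<forall>v\<in>V. u v * (v \<bullet> n) = 0"
      using un V sum_nonneg_eq_0_iff[of V "\<lambda>v. - (u v * (v \<bullet> n))"] by (simp add: sum_negf)
    then have z: "\<forall>v\<in>V. u v \<noteq> 0 \<longrightarrow> v \<bullet> n = 0" by auto
    define V0 where "V0 = {v \<in> V. v \<bullet> n = 0}"
    have "sum u V0 = sum u V" "(\<Sum>v\<in>V0. u v *\<^sub>R v) = (\<Sum>v\<in>V. u v *\<^sub>R v)"
      using V z by (auto simp: V0_def intro!: sum.mono_neutral_left)
    then have "x \<in> convex hull V0"
      using u V by (auto simp: V0_def convex_hull_finite intro!: exI[of _ u])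
    moreover have sub: "convex hull V0 \<subseteq> slice (convex hull V) n"
      by (intro hull_minimal convex_slice convex_convex_hull)
        (auto simp: V0_def slice_def inner_commute hull_inc)
    ultimately have "x extreme_point_of (convex hull V0)"
      using x by (auto simp: extreme_point_of_def)
    then show ?thesis using extreme_point_of_convex_hull V0_def by blast
  qed
qed

text \<open>Two nonparallel segments of \<open>K\<close> crossing at \<open>x\<close> span a parallelogram in \<open>K\<close>, which meets the
  hyperplane in a segment around \<open>x\<close>.\<close>

lemma transversal_segments_parallel:
  fixes e e' :: "'a::euclidean_space"
  assumes K: "convex K" and x: "x extreme_point_of slice K n"
    and e: "x + e \<in> K" "x - e \<in> K" "n \<bullet> e \<noteq> 0"
    and e': "x + e' \<in> K" "x - e' \<in> K" "n \<bullet> e' \<noteq> 0"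
  shows "span {e} = span {e'}"
proof -
  define \<delta> where "\<delta> = min \<bar>n \<bullet> e\<bar> \<bar>n \<bullet> e'\<bar>"
  have \<delta>: "\<delta> > 0" "\<delta> \<le> \<bar>n \<bullet> e\<bar>" "\<delta> \<le> \<bar>n \<bullet> e'\<bar>" using e e' by (auto simp: \<delta>_def)
  have seg: "x + c *\<^sub>R d \<in> K" if "x + d \<in> K" "x - d \<in> K" "\<bar>c\<bar> \<le> 1" for c d
  proof -
    have "((1 + c) / 2) *\<^sub>R (x + d) + ((1 - c) / 2) *\<^sub>R (x - d) \<in> K"
      using that K by (intro convexD) (auto simp: field_simps)
    moreover have "((1 + c) / 2) *\<^sub>R (x + d) + ((1 - c) / 2) *\<^sub>R (x - d) = x + c *\<^sub>R d"
    proof -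
      have "((1 + c) / 2) *\<^sub>R (x + d) + ((1 - c) / 2) *\<^sub>R (x - d)
        = ((1 + c) / 2 + (1 - c) / 2) *\<^sub>R x + ((1 + c) / 2 - (1 - c) / 2) *\<^sub>R d"
        unfolding scaleR_left_diff_distrib scaleR_left_distrib by (simp add: algebra_simps)
      also have "\<dots> = x + c *\<^sub>R d" by (simp add: field_simps)
      finally show ?thesis .
    qed
    ultimately show ?thesis by simp
  qed
  \<comment> \<open>\<open>c\<close> and \<open>c'\<close> scale both segments to the same height
    \<open>\<delta>\<close> above the hyperplane, so that \<open>w\<close> lies in it.\<close>
  define c where "c = \<delta> / (n \<bullet> e)"
  define c' where "c' = \<delta> / (n \<bullet> e')"
  have c: "\<bar>c\<bar> \<le> 1" "\<bar>c'\<bar> \<le> 1" "c \<noteq> 0" "c' \<noteq> 0"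
    using \<delta> e e' by (auto simp: c_def c'_def field_simps)
  define w where "w = c' *\<^sub>R e' - c *\<^sub>R e"
  have nw: "n \<bullet> w = 0" using e e' by (simp add: w_def c_def c'_def inner_simps)
  have mid: "(1 / 2) *\<^sub>R a + (1 / 2) *\<^sub>R b \<in> K" if "a \<in> K" "b \<in> K" for a b
    using K that by (intro convexD) auto
  have "x + (1 / 2) *\<^sub>R w = (1 / 2) *\<^sub>R (x + c' *\<^sub>R e') + (1 / 2) *\<^sub>R (x + (- c) *\<^sub>R e)"
    by (simp add: w_def algebra_simps flip: scaleR_left_distrib)
  then have "x + (1 / 2) *\<^sub>R w \<in> K"
    using mid[OF seg[OF e'(1,2) c(2)] seg[OF e(1,2), of "- c"]] c by simp
  moreover have "x - (1 / 2) *\<^sub>R w = (1 / 2) *\<^sub>R (x + c *\<^sub>R e) + (1 / 2) *\<^sub>R (x + (- c') *\<^sub>R e')"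
    by (simp add: w_def algebra_simps flip: scaleR_left_distrib)
  then have "x - (1 / 2) *\<^sub>R w \<in> K"
    using mid[OF seg[OF e(1,2) c(1)] seg[OF e'(1,2), of "- c'"]] c by simp
  moreover have "n \<bullet> x = 0" using x by (simp add: extreme_point_of_def slice_def)
  ultimately have sl: "x + (1 / 2) *\<^sub>R w \<in> slice K n" "x - (1 / 2) *\<^sub>R w \<in> slice K n"
    using nw by (simp_all add: slice_def inner_simps)
  have "w = 0"
  proof (rule ccontr)
    assume "w \<noteq> 0"
    have "x = midpoint (x + (1 / 2) *\<^sub>R w) (x - (1 / 2) *\<^sub>R w)"
      by (simp add: midpoint_def algebra_simps flip: scaleR_left_distrib)
    moreover have "x + (1 / 2) *\<^sub>R w \<noteq> x - (1 / 2) *\<^sub>R w"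
    proof
      assume "x + (1 / 2) *\<^sub>R w = x - (1 / 2) *\<^sub>R w"
      then have "(1 / 2) *\<^sub>R w + (1 / 2) *\<^sub>R w = 0" by (simp add: algebra_simps)
      then show False using \<open>w \<noteq> 0\<close> by (simp flip: scaleR_left_distrib)
    qed
    ultimately have "x \<in> open_segment (x + (1 / 2) *\<^sub>R w) (x - (1 / 2) *\<^sub>R w)"
      by (metis midpoint_in_open_segment)
    then show False using x sl by (simp add: extreme_point_of_def)
  qed
  then have "e = (c' / c) *\<^sub>R e'"
    using c by (simp add: w_def divide_inverse) (metis inverse_eq_divide right_inverse scaleR_one scaleR_scaleR mult.commute)
  then have "e \<in> span {e'}" by (auto simp: span_singleton)
  then show ?thesis using e(3) by (intro span_singleton_eq) auto
qed

text \<open>\<open>x\<close> is interior to both segments, so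
  \<open>transversal_segments_parallel\<close> applies to short pieces centred at \<open>x\<close>.
  An extreme point thus determines its direction, whichever crossing pair represents it.\<close>

lemma crossing_direction_unique:
  fixes K :: "'a::euclidean_space set"
  assumes K: "convex K" and x: "x extreme_point_of slice K n"
    and y: "y \<in> K" "y' \<in> K" "y \<bullet> n > 0" "y' \<bullet> n < 0" "x = line_cut y' (y - y') n"
    and z: "z \<in> K" "z' \<in> K" "z \<bullet> n > 0" "z' \<bullet> n < 0" "x = line_cut z' (z - z') n"
  shows "span {y - y'} = span {z - z'}"
proof -
  have *: "\<exists>\<epsilon>>0. x + \<epsilon> *\<^sub>R (y - y') \<in> K \<and> x - \<epsilon> *\<^sub>R (y - y') \<in> K"
    if y: "y \<in> K" "y' \<in> K" "y \<bullet> n > 0" "y' \<bullet> n < 0" "x = line_cut y' (y - y') n" for y y'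
  proof -
    obtain t where t: "0 < t" "t < 1" "x = (1 - t) *\<^sub>R y' + t *\<^sub>R y"
      using line_cut_in_open_segment[OF y(3,4)] y(5) by metis
    define \<epsilon> where "\<epsilon> = min t (1 - t)"
    have \<epsilon>: "\<epsilon> > 0" "\<epsilon> \<le> t" "\<epsilon> \<le> 1 - t" using t by (auto simp: \<epsilon>_def)
    have "x + \<epsilon> *\<^sub>R (y - y') = (1 - (t + \<epsilon>)) *\<^sub>R y' + (t + \<epsilon>) *\<^sub>R y"
      "x - \<epsilon> *\<^sub>R (y - y') = (1 - (t - \<epsilon>)) *\<^sub>R y' + (t - \<epsilon>) *\<^sub>R y"
      unfolding t(3) by (simp_all add: algebra_simps)
    moreover have "(1 - (t + \<epsilon>)) *\<^sub>R y' + (t + \<epsilon>) *\<^sub>R y \<in> K" "(1 - (t - \<epsilon>)) *\<^sub>R y' + (t - \<epsilon>) *\<^sub>R y \<in> K"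
      using K y \<epsilon> t by (auto intro!: convexD)
    ultimately show ?thesis using \<epsilon> by auto
  qed
  obtain \<epsilon> where \<epsilon>: "\<epsilon> > 0" "x + \<epsilon> *\<^sub>R (y - y') \<in> K" "x - \<epsilon> *\<^sub>R (y - y') \<in> K"
    using *[OF y] by blast
  obtain \<eta> where \<eta>: "\<eta> > 0" "x + \<eta> *\<^sub>R (z - z') \<in> K" "x - \<eta> *\<^sub>R (z - z') \<in> K"
    using *[OF z] by blast
  have "span {\<epsilon> *\<^sub>R (y - y')} = span {\<eta> *\<^sub>R (z - z')}"
    using \<epsilon> \<eta> y z by (intro transversal_segments_parallel[OF K x]) (auto simp: inner_simps inner_commute)
  moreover have "span {c *\<^sub>R u} = span {u}" if "c > 0" for c and u :: 'a
    using that by (cases "u = 0") (auto intro!: span_singleton_eq[of _ u] simp: span_scale span_base)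
  ultimately show ?thesis using \<epsilon> \<eta> by simp
qed

section \<open>Persistence of extreme points when the hyperplane is perturbed\<close>

text \<open>Some hyperplane separates the extreme point \<open>x\<close> from all candidates placed
  elsewhere at \<open>n0\<close>, and still does so near \<open>n0\<close>. If only those were
  extreme in \<open>K\<close>, all of \<open>K\<close> would lie beyond it, contrary to
  \<open>f b n\<close> in \<open>K\<close>. Since \<open>R\<close> is quantified after
  \<open>n\<close>, it can select the pairs that cross for that \<open>n\<close>.\<close>

lemma extreme_points_persist:
  fixes f :: "'i \<Rightarrow> 'b::topological_space \<Rightarrow> 'a::euclidean_space"
  assumes A: "finite A" and f: "\<And>a. a \<in> A \<Longrightarrow> (f a \<longlongrightarrow> f a n0) (nhds n0)"
    and K0: "convex K0" "x extreme_point_of K0" "\<And>a. a \<in> A \<Longrightarrow> f a n0 \<in> K0"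
    and b: "b \<in> A" "f b n0 = x"
  shows "\<forall>\<^sub>F n in nhds n0. \<forall>K R. compact K \<longrightarrow> convex K \<longrightarrow> f b n \<in> K \<longrightarrow>
    (\<forall>z. z extreme_point_of K \<longrightarrow> (\<exists>a\<in>A. R a \<and> z = f a n)) \<longrightarrow>
    (\<exists>a\<in>A. R a \<and> f a n0 = x \<and> f a n extreme_point_of K)"
proof -
  define B where "B = {a \<in> A. f a n0 \<noteq> x}"
  define M where "M = convex hull ((\<lambda>a. f a n0) ` B)"
  have "M \<subseteq> K0 - {x}"
    unfolding M_def
  proof (rule hull_minimal)
    show "(\<lambda>a. f a n0) ` B \<subseteq> K0 - {x}" using K0(3) by (auto simp: B_def)
    show "convex (K0 - {x})" using K0(1,2) extreme_point_of_stillconvex by blast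
  qed
  then have "x \<notin> M" by auto
  moreover have "closed M" "convex M"
    unfolding M_def using A by (auto simp: B_def intro!: compact_imp_closed finite_imp_compact_convex_hull)
  ultimately obtain c \<beta> where c: "c \<bullet> x < \<beta>" "\<forall>z\<in>M. \<beta> < c \<bullet> z"
    using separating_hyperplane_closed_point[of M x] by metis
  have "\<forall>\<^sub>F n in nhds n0. c \<bullet> f b n < \<beta>"
    using f[OF b(1)] b c by (intro order_tendstoD(2)[of _ "c \<bullet> x"] tendsto_intros) auto
  moreover have "\<forall>\<^sub>F n in nhds n0. \<forall>a\<in>B. \<beta> < c \<bullet> f a n"
  proof (rule eventually_ball_finite)
    show "finite B" using A by (simp add: B_def)
    show "\<forall>a\<in>B. \<forall>\<^sub>F n in nhds n0. \<beta> < c \<bullet> f a n"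
    proof
      fix a assume a: "a \<in> B"
      then have "f a n0 \<in> M" unfolding M_def by (intro hull_inc) auto
      then have "\<beta> < c \<bullet> f a n0" using c by auto
      moreover have "((\<lambda>n. c \<bullet> f a n) \<longlongrightarrow> c \<bullet> f a n0) (nhds n0)"
        using a f by (intro tendsto_intros) (auto simp: B_def)
      ultimately show "\<forall>\<^sub>F n in nhds n0. \<beta> < c \<bullet> f a n"
        by (rule order_tendstoD(1)[rotated])
    qed
  qed
  ultimately show ?thesis
  proof eventually_elim
    case (elim n)
    show ?case
    proof (intro allI impI)
      fix K R
      assume K: "compact K" "convex K" "f b n \<in> K"
        and ext: "\<forall>z. z extreme_point_of K \<longrightarrow> (\<exists>a\<in>A. R a \<and> z = f a n)"
      show "\<exists>a\<in>A. R a \<and> f a n0 = x \<and> f a n extreme_point_of K"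
      proof (rule ccontr)
        assume no: "\<not> ?thesis"
        have "{z. z extreme_point_of K} \<subseteq> {z. c \<bullet> z > \<beta>}"
        proof
          fix z assume "z \<in> {z. z extreme_point_of K}"
          then obtain a where "a \<in> A" "R a" "z = f a n" "f a n extreme_point_of K" using ext by blast
          then show "z \<in> {z. c \<bullet> z > \<beta>}" using no elim by (auto simp: B_def)
        qed
        then have "convex hull {z. z extreme_point_of K} \<subseteq> {z. c \<bullet> z > \<beta>}"
          by (intro hull_minimal convex_halfspace_gt)
        then have "K \<subseteq> {z. c \<bullet> z > \<beta>}" using Krein_Milman_Minkowski K by blast
        then show False using K elim by auto
      qed
    qed
  qed
qed

lemma subspace_subset_span_ball:
  fixes H :: "'a::real_normed_vector set"
  assumes H: "subspace H" and r: "0 < r" "ball 0 r \<inter> H \<subseteq> S"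
  shows "H \<subseteq> span S"
proof
  fix h assume h: "h \<in> H"
  show "h \<in> span S"
  proof (cases "h = 0")
    case False
    define g where "g = (r / (2 * norm h)) *\<^sub>R h"
    have "norm g = r / 2" using False r by (simp add: g_def)
    then have "g \<in> ball 0 r \<inter> H" using h H r by (simp add: g_def subspace_scale)
    then have "g \<in> span S" using r span_base by blast
    moreover have "h = (2 * norm h / r) *\<^sub>R g" using False r by (simp add: g_def)
    ultimately show ?thesis by (metis span_scale)
  qed (simp add: span_zero)
qed

lemma zero_not_extreme_point:
  fixes H :: "'a::euclidean_space set"
  assumes H: "subspace H" "h \<in> H" "h \<noteq> 0" and r: "0 < r" "ball 0 r \<inter> H \<subseteq> S"
  shows "\<not> 0 extreme_point_of S"
proof
  assume z: "0 extreme_point_of S"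
  define g where "g = (r / (2 * norm h)) *\<^sub>R h"
  have ng: "norm g = r / 2" "g \<noteq> 0" using H r by (simp_all add: g_def)
  then have "g \<in> S" "- g \<in> S"
    using r H by (auto simp: g_def subspace_scale subspace_neg intro!: subsetD[OF r(2)])
  moreover have "0 \<in> open_segment (- g) g"
  proof -
    have "0 = midpoint (- g) g" by (simp add: midpoint_def)
    moreover have "- g \<noteq> g"
    proof
      assume "- g = g"
      then have "2 *\<^sub>R g = 0" unfolding scaleR_2 by (metis add.left_inverse)
      then show False using ng by simp
    qed
    ultimately show ?thesis by (metis midpoint_in_open_segment)
  qed
  ultimately show False using z by (simp add: extreme_point_of_def)
qed

text \<open>
  The section by \<open>n0\<^sup>\<bottom>\<close> has besides \<open>p\<close> an extreme point \<open>x\<close> in the interior of an edge, whose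
  direction persists for \<open>n\<close> near \<open>n0\<close>. On either side of \<open>p\<close> some extreme point lies on an edge emanating
  from \<open>p\<close> to the opposite side; if both of these were parallel to the edge through \<open>x\<close>, then
  \<open>p\<close> would lie between their other endpoints.
\<close>

lemma nonparallel_edges_near_vertex:
  fixes V :: "'a::euclidean_space set"
  assumes V: "finite V" "\<And>y. y \<in> V \<Longrightarrow> y extreme_point_of (convex hull V)"
    and W: "subspace W" and r: "0 < r" "ball 0 r \<inter> W \<subseteq> convex hull V"
    and p: "p \<in> V" "p \<bullet> n0 = 0"
    and n0: "n0 \<in> W" "n0 \<noteq> 0" and dim: "2 \<le> dim (W \<inter> {m. n0 \<bullet> m = 0})"
    and off: "\<And>y. y \<in> V \<Longrightarrow> y \<bullet> n0 = 0 \<Longrightarrow> y \<in> span {p}"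
  shows "\<exists>s\<in>{1, -1}. \<forall>\<^sub>F n in nhds n0. s * (p \<bullet> n) > 0 \<longrightarrow>
    (\<exists>y\<in>V. \<exists>y'\<in>V. \<exists>z\<in>V. \<exists>z'\<in>V. y \<bullet> n > 0 \<and> y' \<bullet> n < 0 \<and> z \<bullet> n > 0 \<and> z' \<bullet> n < 0 \<and>
      line_cut y' (y - y') n extreme_point_of slice (convex hull V) n \<and>
      line_cut z' (z - z') n extreme_point_of slice (convex hull V) n \<and>
      span {y - y'} \<noteq> span {z - z'})"
proof -
  define K where "K = convex hull V"
  have K: "convex K" "compact K" using V by (simp_all add: K_def finite_imp_compact_convex_hull)
  have VK: "y \<in> K" if "y \<in> V" for y using that by (simp add: K_def hull_inc)
  define f where "f = (\<lambda>(y, y') (n :: 'a). line_cut y' (y - y') n)"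
  \<comment> \<open>Weak inequalities admit pairs with one endpoint on
    \<open>n0\<^sup>\<bottom>\<close>, such as \<open>p\<close>; their cut at \<open>n0\<close> is
    that endpoint.\<close>
  define A where "A = {(y, y'). y \<in> V \<and> y' \<in> V \<and> y \<bullet> n0 \<ge> 0 \<and> y' \<bullet> n0 \<le> 0}"
  define R where "R = (\<lambda>(n :: 'a) (y, y'). y \<bullet> n > 0 \<and> y' \<bullet> n < (0::real))"
  have finA: "finite A" using V(1) by (intro finite_subset[of A "V \<times> V"]) (auto simp: A_def)
  have V0: "y \<noteq> 0" if "y \<in> V" for y
    using V(2)[OF that] zero_not_extreme_point[OF W n0 r] by auto
  have K00: "0 \<in> K" using r W by (auto simp: K_def subspace_0 intro!: subsetD[OF r(2)])
  \<comment> \<open>Both vertices lie on the line through 0 and \<open>p\<close>, so the numerator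
    vanishes. The cut is 0 for every \<open>n\<close>, hence continuous at \<open>n0\<close> despite
    the zero denominator.\<close>
  have f0: "f (y, y') n = 0" if "(y, y') \<in> A" "y \<bullet> n0 = y' \<bullet> n0" for y y' n
  proof -
    have "y \<in> span {p}" "y' \<in> span {p}" using that off by (auto simp: A_def)
    then obtain c c' where "y = c *\<^sub>R p" "y' = c' *\<^sub>R p" by (auto simp: span_singleton)
    then show ?thesis by (simp add: f_def line_cut_def line_num_def inner_simps algebra_simps)
  qed
  have tendsto: "(f a \<longlongrightarrow> f a n0) (nhds n0)" if a: "a \<in> A" for a
  proof -
    obtain y y' where yy: "a = (y, y')" by (cases a)
    show ?thesis
    proof (cases "y \<bullet> n0 = y' \<bullet> n0")
      case True
      then have "f a = (\<lambda>n. 0)" using f0 a yy by blast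
      then show ?thesis by simp
    next
      case False
      then have "(y - y') \<bullet> n0 \<noteq> 0" by (simp add: inner_simps)
      moreover have "((\<lambda>n. n) \<longlongrightarrow> n0) (nhds n0)" by (simp add: filterlim_ident)
      ultimately show ?thesis
        unfolding yy f_def prod.case line_cut_def line_num_def by (intro tendsto_intros)
    qed
  qed
  have fK: "f a n0 \<in> slice K n0" if "a \<in> A" for a
  proof -
    obtain y y' where yy: "a = (y, y')" by (cases a)
    show ?thesis
    proof (cases "y \<bullet> n0 = y' \<bullet> n0")
      case True
      then show ?thesis using f0[of y y'] that yy K00 by (simp add: slice_def)
    next
      case False
      then show ?thesis using that yy K VK unfolding f_def
        by (auto simp: A_def intro!: line_cut_mem_slice)
    qed
  qed
  \<comment> \<open>Otherwise a half-space with 0 on its boundary would contain the ball about 0 in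
    \<open>W\<close>.\<close>
  have pos: "\<exists>y\<in>V. c * (y \<bullet> n0) > 0" if "c \<noteq> 0" for c
  proof (rule ccontr)
    assume "\<not> ?thesis"
    define h where "h = c *\<^sub>R n0"
    have h: "h \<in> W" "h \<noteq> 0" using that n0 W by (simp_all add: h_def subspace_scale)
    have "V \<subseteq> {m. h \<bullet> m \<le> 0}"
      using \<open>\<not> (\<exists>y\<in>V. c * (y \<bullet> n0) > 0)\<close> by (auto simp: h_def inner_commute not_less)
    then have sub: "K \<subseteq> {m. h \<bullet> m \<le> 0}"
      unfolding K_def by (intro hull_minimal convex_halfspace_le)
    define g where "g = (r / (2 * norm h)) *\<^sub>R h"
    have "norm g = r / 2" using h r by (simp add: g_def)
    moreover have "g \<in> W" using W h by (simp add: g_def subspace_scale)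
    ultimately have "g \<in> K" using r by (auto simp: K_def intro!: subsetD[OF r(2)])
    then have "h \<bullet> g \<le> 0" using sub by blast
    moreover have "h \<bullet> g > 0" using h r by (simp add: g_def)
    ultimately show False by linarith
  qed
  obtain u where u: "u \<in> V" "u \<bullet> n0 > 0" using pos[of 1] by auto
  obtain u' where u': "u' \<in> V" "u' \<bullet> n0 < 0" using pos[of "-1"] by auto
  \<comment> \<open>Vertices off \<open>n0\<^sup>\<bottom>\<close> keep their side, so a pair
    crossing at \<open>n\<close> is weakly separated at \<open>n0\<close>.\<close>
  have ext_slice: "\<exists>a\<in>A. R n a \<and> x = f a n"
    if ex: "x extreme_point_of slice K n" "\<forall>y\<in>V. y \<bullet> n \<noteq> 0"
      and same: "\<forall>y\<in>V. y \<bullet> n0 \<noteq> 0 \<longrightarrow> (y \<bullet> n) * (y \<bullet> n0) > 0" for x n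
  proof -
    have "x \<notin> V" using ex by (auto simp: extreme_point_of_def slice_def inner_commute)
    then obtain y y' where y: "y \<in> V" "y' \<in> V" "y \<bullet> n > 0" "y' \<bullet> n < 0" "x = line_cut y' (y - y') n"
      using extreme_point_of_slice_hull[OF V(1)] ex(1) unfolding K_def by blast
    have "y \<bullet> n0 \<ge> 0" using same y by (metis mult_pos_neg not_less order_less_asym order.refl)
    moreover have "y' \<bullet> n0 \<le> 0" using same y by (metis mult_neg_pos not_less order_less_asym order.refl)
    ultimately show ?thesis using y by (intro bexI[of _ "(y, y')"]) (auto simp: R_def A_def f_def)
  qed
  have p_ext: "p extreme_point_of slice K n0"
    using V(2)[OF p(1)] p by (auto simp: extreme_point_of_def slice_def K_def inner_commute)
  \<comment> \<open>Were all extreme points on the line through 0 and \<open>p\<close>, the section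
    would be, too, although it spans at least two dimensions.\<close>
  obtain x where x: "x extreme_point_of slice K n0" "x \<notin> span {p}"
  proof -
    have "\<not> {z. z extreme_point_of slice K n0} \<subseteq> span {p}"
    proof
      assume "{z. z extreme_point_of slice K n0} \<subseteq> span {p}"
      then have "convex hull {z. z extreme_point_of slice K n0} \<subseteq> span {p}"
        by (intro hull_minimal) (auto simp: subspace_imp_convex)
      then have sub: "slice K n0 \<subseteq> span {p}"
        using Krein_Milman_Minkowski[OF compact_slice convex_slice] K by metis
      have H: "subspace (W \<inter> {m. n0 \<bullet> m = 0})"
        by (intro subspace_inter W) (simp add: subspace_hyperplane)
      have "W \<inter> {m. n0 \<bullet> m = 0} \<subseteq> span (slice K n0)"
        using r by (intro subspace_subset_span_ball[OF H r(1)]) (auto simp: slice_def K_def)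
      also have "\<dots> \<subseteq> span {p}" using sub by (simp add: span_minimal)
      finally have "dim (W \<inter> {m. n0 \<bullet> m = 0}) \<le> dim {p}" by (metis dim_span dim_subset)
      also have "\<dots> \<le> 1" using dim_le_card[of "{p}"] by (simp add: span_superset)
      finally show False using dim by simp
    qed
    then show ?thesis using that by blast
  qed
  have xV: "x \<notin> V" using x off by (auto simp: extreme_point_of_def slice_def inner_commute)
  then obtain w w' where w: "w \<in> V" "w' \<in> V" "w \<bullet> n0 > 0" "w' \<bullet> n0 < 0" "x = line_cut w' (w - w') n0"
    using extreme_point_of_slice_hull[OF V(1)] x(1) unfolding K_def by blast
  have to_x: "a \<bullet> n0 > 0 \<and> b \<bullet> n0 < 0 \<and> span {a - b} = span {w - w'}"
    if "(a, b) \<in> A" "f (a, b) n0 = x" for a b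
  proof -
    have "x \<noteq> 0" using x(2) by (auto simp: span_zero)
    then have ne: "a \<bullet> n0 \<noteq> b \<bullet> n0" using f0 that by metis
    have "a \<bullet> n0 \<noteq> 0" "b \<bullet> n0 \<noteq> 0"
      using line_cut_endpoint[OF ne] that xV by (auto simp: A_def f_def)
    then have ab: "a \<bullet> n0 > 0" "b \<bullet> n0 < 0" using that by (auto simp: A_def)
    moreover have "span {a - b} = span {w - w'}"
      using that w by (intro crossing_direction_unique[OF K(1) x(1) _ _ ab _ _ _ w(3,4,5)])
        (auto simp: A_def f_def VK)
    ultimately show ?thesis by simp
  qed
  \<comment> \<open>A vertex is not inside a segment, so a candidate located at \<open>p\<close> has
    \<open>p\<close> as an endpoint.\<close>
  have to_p: "(a = p \<and> b \<bullet> n0 < 0) \<or> (b = p \<and> a \<bullet> n0 > 0)"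
    if "(a, b) \<in> A" "f (a, b) n0 = p" for a b
  proof -
    have ne: "a \<bullet> n0 \<noteq> b \<bullet> n0" using f0 that V0[OF p(1)] by metis
    have "\<not> (a \<bullet> n0 > 0 \<and> b \<bullet> n0 < 0)"
    proof
      assume ab: "a \<bullet> n0 > 0 \<and> b \<bullet> n0 < 0"
      then obtain t where t: "0 < t" "t < 1" "line_cut b (a - b) n0 = (1 - t) *\<^sub>R b + t *\<^sub>R a"
        using line_cut_in_open_segment by blast
      then have "p \<in> open_segment b a"
        using that ab by (auto simp: in_segment f_def)
      then show False using V(2)[OF p(1)] that VK by (auto simp: extreme_point_of_def A_def K_def)
    qed
    then have "a \<bullet> n0 = 0 \<or> b \<bullet> n0 = 0" using that by (auto simp: A_def)
    then show ?thesis
      using line_cut_endpoint[OF ne] that ne by (auto simp: A_def f_def)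
  qed
  have wA: "(w, w') \<in> A" "f (w, w') n0 = x" using w by (auto simp: A_def f_def)
  have puA: "(p, u') \<in> A" "f (p, u') n0 = p" "(u, p) \<in> A" "f (u, p) n0 = p"
    using u u' p line_cut_endpoint[of p n0 u'] line_cut_endpoint[of u n0 p] by (auto simp: A_def f_def)
  have persist: "\<forall>\<^sub>F n in nhds n0. \<forall>L R. compact L \<longrightarrow> convex L \<longrightarrow> f b n \<in> L \<longrightarrow>
      (\<forall>z. z extreme_point_of L \<longrightarrow> (\<exists>a\<in>A. R a \<and> z = f a n)) \<longrightarrow>
      (\<exists>a\<in>A. R a \<and> f a n0 = x \<and> f a n extreme_point_of L)"
    if "x extreme_point_of slice K n0" "b \<in> A" "f b n0 = x" for x b
    by (rule extreme_points_persist[of A f n0, OF finA _ convex_slice[OF K(1)] that(1) _ that(2,3)])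
      (erule tendsto fK)+
  have "\<forall>\<^sub>F n in nhds n0. \<forall>y\<in>V. y \<bullet> n0 \<noteq> 0 \<longrightarrow> (y \<bullet> n) * (y \<bullet> n0) > 0"
  proof (rule eventually_ball_finite[OF V(1)], rule ballI)
    fix y assume "y \<in> V"
    show "\<forall>\<^sub>F n in nhds n0. y \<bullet> n0 \<noteq> 0 \<longrightarrow> (y \<bullet> n) * (y \<bullet> n0) > 0"
    proof (cases "y \<bullet> n0 = 0")
      case False
      have "((\<lambda>n. (y \<bullet> n) * (y \<bullet> n0)) \<longlongrightarrow> (y \<bullet> n0) * (y \<bullet> n0)) (nhds n0)"
        by (intro tendsto_intros) (simp add: filterlim_ident)
      moreover have "(y \<bullet> n0) * (y \<bullet> n0) > 0" using False by (metis not_real_square_gt_zero)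
      ultimately have "\<forall>\<^sub>F n in nhds n0. (y \<bullet> n) * (y \<bullet> n0) > 0" by (rule order_tendstoD(1))
      then show ?thesis by (rule eventually_mono) simp
    qed simp
  qed
  note ev = this persist[OF x(1) wA] persist[OF p_ext puA(1,2)] persist[OF p_ext puA(3,4)]
  \<comment> \<open>\<open>s\<close> will be the sign of \<open>p \<bullet> n\<close>.
    \<open>bad s\<close> says that some vertex on the opposite side is joined to \<open>p\<close> in
    the direction of the edge through \<open>x\<close>.\<close>
  define bad where "bad = (\<lambda>s. \<exists>v\<in>V. s * (v \<bullet> n0) < 0 \<and> span {p - v} = span {w - w'})"
  have "\<exists>s\<in>{1, -1}. \<not> bad s"
  proof (rule ccontr)
    assume "\<not> ?thesis"
    then obtain a b where a: "a \<in> V" "a \<bullet> n0 < 0" "span {p - a} = span {w - w'}"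
      and b: "b \<in> V" "b \<bullet> n0 > 0" "span {p - b} = span {w - w'}"
      unfolding bad_def by auto
    have "p - b \<in> span {p - a}" using a(3) b(3) span_base[of "p - b" "{p - b}"] by simp
    then obtain c where c: "p - b = c *\<^sub>R (p - a)" by (auto simp: span_singleton)
    then have "(p - b) \<bullet> n0 = c * ((p - a) \<bullet> n0)" by simp
    then have "c * (a \<bullet> n0) = b \<bullet> n0" using p by (simp add: inner_simps)
    then have "c < 0" using a b by (metis mult_nonneg_nonpos not_less order_less_imp_le)
    have "(1 - c) *\<^sub>R p = b - c *\<^sub>R a" using c by (simp add: algebra_simps)
    then have "(1 / (1 - c)) *\<^sub>R ((1 - c) *\<^sub>R p) = (1 / (1 - c)) *\<^sub>R (b - c *\<^sub>R a)" by simp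
    then have "p = (1 / (1 - c)) *\<^sub>R b + (- c / (1 - c)) *\<^sub>R a"
      using \<open>c < 0\<close> by (simp add: scaleR_diff_right)
    moreover have "1 / (1 - c) = 1 - (- c / (1 - c))" using \<open>c < 0\<close> by (simp add: field_simps)
    moreover have "0 < - c / (1 - c)" "- c / (1 - c) < 1" using \<open>c < 0\<close> by (simp_all add: field_simps)
    moreover have "a \<noteq> b" using a b by auto
    ultimately have "p \<in> open_segment b a" unfolding in_segment by metis
    then show False using V(2)[OF p(1)] VK a b by (auto simp: extreme_point_of_def K_def)
  qed
  then obtain s where s: "s \<in> {1, -1}" "\<not> bad s" by blast
  have "\<forall>\<^sub>F n in nhds n0. s * (p \<bullet> n) > 0 \<longrightarrow>
    (\<exists>y\<in>V. \<exists>y'\<in>V. \<exists>z\<in>V. \<exists>z'\<in>V. y \<bullet> n > 0 \<and> y' \<bullet> n < 0 \<and> z \<bullet> n > 0 \<and> z' \<bullet> n < 0 \<and>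
      line_cut y' (y - y') n extreme_point_of slice K n \<and>
      line_cut z' (z - z') n extreme_point_of slice K n \<and>
      span {y - y'} \<noteq> span {z - z'})"
    using ev
  proof eventually_elim
    case (elim n)
    show ?case
    proof
      assume sp: "s * (p \<bullet> n) > 0"
      have nV: "\<forall>y\<in>V. y \<bullet> n \<noteq> 0"
      proof
        fix y assume y: "y \<in> V"
        show "y \<bullet> n \<noteq> 0"
        proof (cases "y \<bullet> n0 = 0")
          case True
          then obtain c where "y = c *\<^sub>R p" using off[OF y] by (auto simp: span_singleton)
          then show ?thesis using sp V0[OF y] by auto
        next
          case False
          then show ?thesis using elim(1) y by force
        qed
      qed
      have ex: "\<forall>z. z extreme_point_of slice K n \<longrightarrow> (\<exists>a\<in>A. R n a \<and> z = f a n)"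
        using ext_slice nV elim(1) by blast
      have KK: "compact (slice K n)" "convex (slice K n)"
        using K by (auto intro: compact_slice convex_slice)
      have fmem: "f (y, y') n \<in> slice K n" if "y \<in> V" "y' \<in> V" "y \<bullet> n > 0" "y' \<bullet> n < 0" for y y'
        unfolding f_def using that K VK by (auto intro!: line_cut_mem_slice)
      have "w \<bullet> n > 0" "w' \<bullet> n < 0" "u \<bullet> n > 0" "u' \<bullet> n < 0"
        using elim(1)[rule_format, OF w(1)] elim(1)[rule_format, OF w(2)]
          elim(1)[rule_format, OF u(1)] elim(1)[rule_format, OF u'(1)] w u u'
        by (auto simp: zero_less_mult_iff)
      note sgn = this
      obtain a b where ab: "(a, b) \<in> A" "R n (a, b)" "f (a, b) n0 = x" "f (a, b) n extreme_point_of slice K n"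
        using elim(2)[rule_format, OF KK fmem[OF w(1,2) sgn(1,2)], of "R n"] ex by (metis surj_pair)
      \<comment> \<open>The candidate near \<open>p\<close> known to lie in the section joins
        \<open>p\<close> to \<open>u'\<close> or to \<open>u\<close>, depending on the side of
        \<open>p\<close>.\<close>
      have "\<exists>c d. (c, d) \<in> A \<and> R n (c, d) \<and> f (c, d) n0 = p \<and> f (c, d) n extreme_point_of slice K n"
      proof (cases "p \<bullet> n > 0")
        case True
        then show ?thesis
          using elim(3)[rule_format, OF KK fmem[OF p(1) u'(1) True sgn(4)], of "R n"] ex by (metis surj_pair)
      next
        case False
        then have "p \<bullet> n < 0" using nV p by force
        then show ?thesis
          using elim(4)[rule_format, OF KK fmem[OF u(1) p(1) sgn(3)], of "R n"] ex by (metis surj_pair)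
      qed
      then obtain c d where cd: "(c, d) \<in> A" "R n (c, d)" "f (c, d) n0 = p" "f (c, d) n extreme_point_of slice K n"
        by blast
      have "span {c - d} \<noteq> span {w - w'}"
      proof
        assume eq: "span {c - d} = span {w - w'}"
        have neg: "span {u - v} = span {v - u}" for u v :: 'a
          by (rule span_eq[THEN iffD2]) (metis empty_subsetI insert_subset minus_diff_eq span_base span_neg singletonI)
        have "bad s"
          using to_p[OF cd(1,3)]
        proof
          assume h: "c = p \<and> d \<bullet> n0 < 0"
          then have "s = 1" using sp cd(2) s by (auto simp: R_def)
          then show ?thesis using h eq cd(1) by (auto simp: bad_def A_def)
        next
          assume h: "d = p \<and> c \<bullet> n0 > 0"
          then have "s = -1" using sp cd(2) s by (auto simp: R_def)
          then show ?thesis using h eq cd(1) neg[of p c] by (auto simp: bad_def A_def)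
        qed
        then show False using s by simp
      qed
      then have dir: "span {a - b} \<noteq> span {c - d}" using to_x[OF ab(1,3)] by simp
      show "\<exists>y\<in>V. \<exists>y'\<in>V. \<exists>z\<in>V. \<exists>z'\<in>V. y \<bullet> n > 0 \<and> y' \<bullet> n < 0 \<and> z \<bullet> n > 0 \<and> z' \<bullet> n < 0 \<and>
          line_cut y' (y - y') n extreme_point_of slice K n \<and>
          line_cut z' (z - z') n extreme_point_of slice K n \<and>
          span {y - y'} \<noteq> span {z - z'}"
        by (rule bexI[of _ a], rule bexI[of _ b], rule bexI[of _ c], rule bexI[of _ d])
          (use ab cd dir in \<open>auto simp: A_def R_def f_def\<close>)
    qed
  qed
  then show ?thesis using s unfolding K_def by blast
qed

subsection \<open>Congruent sections\<close>

text \<open>Following \<open>\<phi>\<close> by the translation by \<open>- t\<close> gives an affine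
  isometry of \<open>A\<close> onto \<open>B\<close>; open segments correspond under it, and with
  them the extreme points.\<close>

lemma congruent_in_extreme_points:
  fixes A B :: "'a::euclidean_space set"
  assumes H: "subspace H" and AB: "A \<subseteq> H" "B \<subseteq> H" and "convex A" and "congruent_in H A B"
  shows "\<exists>\<sigma>. bij_betw \<sigma> {x. x extreme_point_of A} {y. y extreme_point_of B} \<and>
    (\<forall>x\<in>{x. x extreme_point_of A}. \<forall>x'\<in>{x. x extreme_point_of A}. norm (\<sigma> x - \<sigma> x') = norm (x - x'))"
proof -
  obtain \<phi> t where \<phi>: "orthogonal_transformation_on H \<phi>" and t: "t \<in> H"
    and img: "\<phi> ` A = (\<lambda>x. t + x) ` B"
    using assms(5) by (auto simp: congruent_in_def)
  have add: "\<phi> (x + y) = \<phi> x + \<phi> y" if "x \<in> H" "y \<in> H" for x y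
    using \<phi> that by (simp add: orthogonal_transformation_on_def)
  have scale: "\<phi> (c *\<^sub>R x) = c *\<^sub>R \<phi> x" if "x \<in> H" for c x
    using \<phi> that by (simp add: orthogonal_transformation_on_def)
  have inner: "\<phi> x \<bullet> \<phi> x = x \<bullet> x" if "x \<in> H" for x
    using \<phi> that by (simp add: orthogonal_transformation_on_def)
  define f where "f = (\<lambda>x. \<phi> x - t)"
  have fA: "f ` A = B"
  proof -
    have "f ` A = (\<lambda>x. x - t) ` (\<phi> ` A)" by (simp add: f_def image_image)
    then show ?thesis by (simp add: img image_image)
  qed
  have iso: "norm (f x - f y) = norm (x - y)" if "x \<in> H" "y \<in> H" for x y
  proof -
    have xy: "x - y \<in> H" using that H by (simp add: subspace_diff)
    have "f x - f y = \<phi> (x - y)"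
      using add[OF xy that(2)] by (simp add: f_def)
    then show ?thesis using inner[OF xy] by (simp add: norm_eq_sqrt_inner)
  qed
  have inj: "x = y" if "x \<in> H" "y \<in> H" "f x = f y" for x y
    using iso[OF that(1,2)] that(3) by simp
  have aff: "f ((1 - u) *\<^sub>R x + u *\<^sub>R y) = (1 - u) *\<^sub>R f x + u *\<^sub>R f y" if "x \<in> H" "y \<in> H" for u x y
  proof -
    have "(1 - u) *\<^sub>R x \<in> H" "u *\<^sub>R y \<in> H" using that H by (simp_all add: subspace_scale)
    then have "\<phi> ((1 - u) *\<^sub>R x + u *\<^sub>R y) = (1 - u) *\<^sub>R \<phi> x + u *\<^sub>R \<phi> y"
      using that by (simp only: add scale)
    then show ?thesis by (simp add: f_def algebra_simps)
  qed
  have seg: "f x \<in> open_segment (f a) (f b) \<longleftrightarrow> x \<in> open_segment a b"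
    if "x \<in> A" "a \<in> A" "b \<in> A" for x a b
  proof -
    have xH: "x \<in> H" "a \<in> H" "b \<in> H" using that AB by auto
    have "f x = (1 - u) *\<^sub>R f a + u *\<^sub>R f b \<longleftrightarrow> x = (1 - u) *\<^sub>R a + u *\<^sub>R b" for u
    proof -
      have "(1 - u) *\<^sub>R a + u *\<^sub>R b \<in> H" using xH H by (simp add: subspace_add subspace_scale)
      then show ?thesis unfolding aff[OF xH(2,3), symmetric] using inj[OF xH(1)] by blast
    qed
    moreover have "f a = f b \<longleftrightarrow> a = b" using inj xH by blast
    ultimately show ?thesis unfolding in_segment by simp
  qed
  have ext: "f x extreme_point_of B \<longleftrightarrow> x extreme_point_of A" if "x \<in> A" for x
    using that seg[OF that] unfolding extreme_point_of_def fA[symmetric] by auto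
  have "bij_betw f {x. x extreme_point_of A} {y. y extreme_point_of B}"
    unfolding bij_betw_def
  proof
    show "inj_on f {x. x extreme_point_of A}"
      using inj AB by (auto simp: inj_on_def extreme_point_of_def)
    have "\<exists>x. x extreme_point_of A \<and> y = f x" if "y extreme_point_of B" for y
    proof -
      have "y \<in> f ` A" using that fA by (simp add: extreme_point_of_def)
      then show ?thesis using ext that by blast
    qed
    moreover have "x \<in> A" if "x extreme_point_of A" for x using that by (simp add: extreme_point_of_def)
    ultimately show "f ` {x. x extreme_point_of A} = {y. y extreme_point_of B}"
      using ext by auto
  qed
  moreover have "norm (f x - f x') = norm (x - x')"
    if "x extreme_point_of A" "x' extreme_point_of A" for x x'
    using that AB by (intro iso) (auto simp: extreme_point_of_def)
  ultimately show ?thesis by (intro exI[of _ f]) auto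
qed

section \<open>Sections by generic hyperplanes of a subspace\<close>

lemma dim_Int_hyperplane_ge:
  fixes W :: "'a::euclidean_space set"
  assumes W: "subspace W"
  shows "dim W \<le> dim (W \<inter> {m. n \<bullet> m = 0}) + 1"
proof (cases "n = 0")
  case False
  have "dim {x + y |x y. x \<in> W \<and> y \<in> {m. n \<bullet> m = 0}} + dim (W \<inter> {m. n \<bullet> m = 0})
      = dim W + dim {m. n \<bullet> m = 0}"
    by (intro dim_sums_Int W subspace_hyperplane)
  moreover have "dim {m. n \<bullet> m = 0} = DIM('a) - 1" using False by (rule dim_hyperplane)
  moreover have "dim {x + y |x y. x \<in> W \<and> y \<in> {m. n \<bullet> m = 0}} \<le> DIM('a)" by (rule dim_subset_UNIV)
  moreover have "DIM('a) \<ge> 1" by (simp add: Suc_leI)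
  ultimately show ?thesis by linarith
qed simp

lemma gap_diff_line_num_cong:
  assumes "\<And>m. line_num x d m = line_num q d m" "\<And>m. line_num x' d' m = line_num q' d' m"
    "\<And>m. line_num y e m = line_num v e m" "\<And>m. line_num y' e' m = line_num v' e' m"
  shows "gap_diff x d x' d' y e y' e' = gap_diff q d q' d' v e v' e'"
  by (simp add: fun_eq_iff gap_diff_def gap_def assms)

text \<open>The section contains a ball about 0 of its hyperplane, so its extreme points span it. As
  0 lies in their affine hull, affine and linear dimension agree and are at least 2, which needs
  three points. No vertex is on the hyperplane, so each extreme point is a proper crossing.\<close>

lemma slice_extreme_points:
  fixes V :: "'a::euclidean_space set"
  assumes V: "finite V" "V \<subseteq> W" and W: "subspace W" and r: "0 < r" "ball 0 r \<inter> W \<subseteq> convex hull V"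
    and dim: "2 \<le> dim (W \<inter> {m. n \<bullet> m = 0})" and nV: "\<forall>y\<in>V. y \<bullet> n \<noteq> 0"
  defines "X \<equiv> {x. x extreme_point_of slice (convex hull V) n}"
  shows "card X \<ge> 3" "span X = W \<inter> {m. n \<bullet> m = 0}" "0 \<notin> X"
    and "slice (convex hull V) n = convex hull X"
    and "\<And>x. x \<in> X \<Longrightarrow> \<exists>y\<in>V. \<exists>y'\<in>V. y \<bullet> n > 0 \<and> y' \<bullet> n < 0 \<and> x = line_cut y' (y - y') n"
proof -
  define H where "H = W \<inter> {m. n \<bullet> m = 0}"
  have H: "subspace H" unfolding H_def
    by (intro subspace_inter W) (simp add: subspace_hyperplane)
  have KW: "convex hull V \<subseteq> W"
    using V W by (simp add: hull_minimal subspace_imp_convex)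
  have KX: "slice (convex hull V) n = convex hull X"
    unfolding X_def using V
    by (intro Krein_Milman_Minkowski compact_slice convex_slice) (auto intro: finite_imp_compact_convex_hull)
  then show "slice (convex hull V) n = convex hull X" .
  have ball: "ball 0 r \<inter> H \<subseteq> slice (convex hull V) n"
    using r by (auto simp: H_def slice_def)
  show crossing: "\<exists>y\<in>V. \<exists>y'\<in>V. y \<bullet> n > 0 \<and> y' \<bullet> n < 0 \<and> x = line_cut y' (y - y') n" if "x \<in> X" for x
  proof -
    have x: "x extreme_point_of slice (convex hull V) n" using that by (simp add: X_def)
    then have "x \<bullet> n = 0" by (simp add: extreme_point_of_def slice_def inner_commute)
    then have "x \<notin> V" using nV by blast
    then show ?thesis using extreme_point_of_slice_hull[OF V(1) x] by blast
  qed
  have "X \<subseteq> (\<lambda>(y, y'). line_cut y' (y - y') n) ` (V \<times> V)"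
    using crossing by force
  then have fin: "finite X" using V(1) by (meson finite_SigmaI finite_imageI finite_subset)
  have XH: "X \<subseteq> H" using KW by (auto simp: X_def H_def extreme_point_of_def slice_def)
  have "H \<subseteq> span (convex hull X)"
    using subspace_subset_span_ball[OF H r(1) ball] KX by simp
  also have "\<dots> \<subseteq> span X"
    by (intro span_minimal convex_hull_subset_span) auto
  finally have HX: "span X = H" using XH H by (simp add: span_minimal subset_antisym)
  then show "span X = W \<inter> {m. n \<bullet> m = 0}" by (simp add: H_def)
  have "\<exists>h\<in>H. h \<noteq> 0"
  proof (rule ccontr)
    assume "\<not> ?thesis"
    then have "H \<subseteq> {0}" by auto
    then have "dim H = 0" by (simp add: dim_eq_0)
    then show False using dim unfolding H_def by linarith
  qed
  then show "0 \<notin> X" unfolding X_def using zero_not_extreme_point[OF H _ _ r(1) ball] by auto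
  have "0 \<in> slice (convex hull V) n" using ball r H by (auto simp: subspace_0)
  then have "0 \<in> affine hull X" using KX convex_hull_subset_affine_hull by blast
  then have "aff_dim X = int (dim X)" by (rule aff_dim_zero)
  moreover have "dim X = dim H" by (metis HX dim_span)
  ultimately have "2 \<le> aff_dim X" using dim by (simp add: H_def)
  then show "card X \<ge> 3" using aff_dim_le_card[OF fin] by linarith
qed

text \<open>A point of \<open>U\<close>, where nonparallel lines are guaranteed, is taken generic
  for a finite list of polynomials depending only on \<open>V\<close> and \<open>V'\<close>; there
  \<open>transversal_points_congruent\<close> applies.\<close>

lemma generic_congruent_slices:
  fixes V V' W U :: "'a::euclidean_space set"
  defines "X \<equiv> \<lambda>n. {x. x extreme_point_of slice (convex hull V) n}"
    and "X' \<equiv> \<lambda>n. {x. x extreme_point_of slice (convex hull V') n}"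
  assumes V: "finite V" "V \<subseteq> W" "0 \<notin> V" and V': "finite V'" "V' \<subseteq> W" "0 \<notin> V'"
    and W: "subspace W" "3 \<le> dim W"
    and r: "0 < r" "ball 0 r \<inter> W \<subseteq> convex hull V" "ball 0 r \<inter> W \<subseteq> convex hull V'"
    and U: "open U" "U \<inter> W \<noteq> {}"
    and iso: "\<And>n. n \<in> W \<Longrightarrow> n \<noteq> 0 \<Longrightarrow> \<exists>\<sigma>. bij_betw \<sigma> (X n) (X' n) \<and>
      (\<forall>x\<in>X n. \<forall>x'\<in>X n. norm (\<sigma> x - \<sigma> x') = norm (x - x'))"
    and nonpar: "\<And>n. n \<in> U \<Longrightarrow>
      \<exists>y\<in>V. \<exists>y'\<in>V. \<exists>z\<in>V. \<exists>z'\<in>V. y \<bullet> n > 0 \<and> y' \<bullet> n < 0 \<and> z \<bullet> n > 0 \<and> z' \<bullet> n < 0 \<and>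
      line_cut y' (y - y') n \<in> X n \<and> line_cut z' (z - z') n \<in> X n \<and> span {y - y'} \<noteq> span {z - z'}"
  shows "\<exists>n\<in>U \<inter> W. slice (convex hull V') n = slice (convex hull V) n \<or>
    slice (convex hull V') n = uminus ` slice (convex hull V) n"
proof -
  \<comment> \<open>Base points and directions of all lines that can cut out an extreme point of a
    section.\<close>
  define C where "C = (\<lambda>(y, y'). (y', y - y')) ` (V \<times> V \<union> V' \<times> V')"
  define gd where "gd = (\<lambda>((x :: 'a, d :: 'a), (x' :: 'a, d' :: 'a), (y :: 'a, e :: 'a), (y' :: 'a, e' :: 'a)).
    gap_diff x d x' d' y e y' e')"
  define ip where "ip = (\<lambda>((x :: 'a, d :: 'a), (x' :: 'a, d' :: 'a)) m. line_num x d m \<bullet> line_num x' d' m)"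
  \<comment> \<open>The three families keep vertices off the hyperplane, turn equal distances into
    identities, and do the same for orthogonality.\<close>
  define F where "F = (\<lambda>y m. y \<bullet> m) ` (V \<union> V') \<union> gd ` (C \<times> C \<times> C \<times> C) \<union> ip ` (C \<times> C)"
  have "finite C" using V V' by (simp add: C_def)
  then have finF: "finite F" unfolding F_def using V V' by simp
  have polyF: "real_polynomial_function f" if "f \<in> F" for f
    using that by (auto simp: F_def gd_def ip_def real_polynomial_function_gap_diff
        real_polynomial_function_line_num_inner real_polynomial_function_inner_left)
  obtain n where n: "n \<in> U \<inter> W" "\<forall>f\<in>F. f n = 0 \<longrightarrow> (\<forall>m\<in>W. f m = 0)"
    using generic_point[OF finF W(1) U polyF] by blast
  have nW: "n \<in> W" using n by simp
  have nV: "y \<bullet> n \<noteq> 0" if "y \<in> V \<union> V'" for y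
  proof
    assume "y \<bullet> n = 0"
    moreover have "(\<lambda>m. y \<bullet> m) \<in> F" using that by (auto simp: F_def)
    ultimately have "\<forall>m\<in>W. y \<bullet> m = 0" using n(2) by blast
    \<comment> \<open>Vertices lie in \<open>W\<close>, so \<open>m = y\<close> is
      admissible.\<close>
    then have "y \<bullet> y = 0" using that V V' by blast
    then show False using that V V' by auto
  qed
  obtain y0 where "y0 \<in> V" using nonpar n by blast
  then have "n \<noteq> 0" using nV by fastforce
  have dim: "2 \<le> dim (W \<inter> {m. n \<bullet> m = 0})" using dim_Int_hyperplane_ge[OF W(1), of n] W by linarith
  have nV1: "\<forall>y\<in>V. y \<bullet> n \<noteq> 0" "\<forall>y\<in>V'. y \<bullet> n \<noteq> 0" using nV by auto
  have Xn: "X n = {x. x extreme_point_of slice (convex hull V) n}"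
    "X' n = {x. x extreme_point_of slice (convex hull V') n}"
    by (simp_all add: X_def X'_def)
  note XV = slice_extreme_points[OF V(1,2) W(1) r(1,2) dim nV1(1), folded Xn]
  note XV' = slice_extreme_points[OF V'(1,2) W(1) r(1,3) dim nV1(2), folded Xn]
  have "\<forall>x\<in>X n. \<exists>qd. fst qd \<in> V \<and> snd qd \<in> V \<and> fst qd \<bullet> n > 0 \<and> snd qd \<bullet> n < 0 \<and>
      x = line_cut (snd qd) (fst qd - snd qd) n"
  proof
    fix x assume "x \<in> X n"
    from XV(5)[OF this] obtain y y' where "y \<in> V" "y' \<in> V" "y \<bullet> n > 0" "y' \<bullet> n < 0"
      "x = line_cut y' (y - y') n" by blast
    then show "\<exists>qd. fst qd \<in> V \<and> snd qd \<in> V \<and> fst qd \<bullet> n > 0 \<and> snd qd \<bullet> n < 0 \<and>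
      x = line_cut (snd qd) (fst qd - snd qd) n"
      by (intro exI[of _ "(y, y')"]) simp
  qed
  then obtain a where a: "\<And>x. x \<in> X n \<Longrightarrow> fst (a x) \<in> V \<and> snd (a x) \<in> V \<and> fst (a x) \<bullet> n > 0 \<and>
      snd (a x) \<bullet> n < 0 \<and> x = line_cut (snd (a x)) (fst (a x) - snd (a x)) n"
    by metis
  have "\<forall>x\<in>X' n. \<exists>qd. fst qd \<in> V' \<and> snd qd \<in> V' \<and> fst qd \<bullet> n > 0 \<and> snd qd \<bullet> n < 0 \<and>
      x = line_cut (snd qd) (fst qd - snd qd) n"
  proof
    fix x assume "x \<in> X' n"
    from XV'(5)[OF this] obtain y y' where "y \<in> V'" "y' \<in> V'" "y \<bullet> n > 0" "y' \<bullet> n < 0"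
      "x = line_cut y' (y - y') n" by blast
    then show "\<exists>qd. fst qd \<in> V' \<and> snd qd \<in> V' \<and> fst qd \<bullet> n > 0 \<and> snd qd \<bullet> n < 0 \<and>
      x = line_cut (snd qd) (fst qd - snd qd) n"
      by (intro exI[of _ "(y, y')"]) simp
  qed
  then obtain b where b: "\<And>x. x \<in> X' n \<Longrightarrow> fst (b x) \<in> V' \<and> snd (b x) \<in> V' \<and> fst (b x) \<bullet> n > 0 \<and>
      snd (b x) \<bullet> n < 0 \<and> x = line_cut (snd (b x)) (fst (b x) - snd (b x)) n"
    by metis
  define D where "D = (\<lambda>x. fst (a x) - snd (a x))"
  define E where "E = (\<lambda>x. fst (b x) - snd (b x))"
  have D: "D x \<in> W \<and> D x \<bullet> n \<noteq> 0" if "x \<in> X n" for x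
    using a[OF that] V(2) W(1) by (auto simp: D_def inner_simps intro!: subspace_diff)
  have E: "E x \<in> W \<and> E x \<bullet> n \<noteq> 0" if "x \<in> X' n" for x
    using b[OF that] V'(2) W(1) by (auto simp: E_def inner_simps intro!: subspace_diff)
  have Dnum: "line_num x (D x) m = line_num (snd (a x)) (D x) m" "(snd (a x), D x) \<in> C" if "x \<in> X n" for x m
  proof -
    show "line_num x (D x) m = line_num (snd (a x)) (D x) m"
      using a[OF that] D[OF that] line_num_line_cut[of "D x" n "snd (a x)" m] by (simp add: D_def)
    show "(snd (a x), D x) \<in> C" using a[OF that] by (force simp: C_def D_def)
  qed
  have Enum: "line_num x (E x) m = line_num (snd (b x)) (E x) m" "(snd (b x), E x) \<in> C" if "x \<in> X' n" for x m
  proof -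
    show "line_num x (E x) m = line_num (snd (b x)) (E x) m"
      using b[OF that] E[OF that] line_num_line_cut[of "E x" n "snd (b x)" m] by (simp add: E_def)
    show "(snd (b x), E x) \<in> C" using b[OF that] by (force simp: C_def E_def)
  qed
  have gen1: "gap_diff x (D x) x' (D x') y (E y) y' (E y') m = 0"
    if "x \<in> X n" "x' \<in> X n" "y \<in> X' n" "y' \<in> X' n" "m \<in> W"
      "gap_diff x (D x) x' (D x') y (E y) y' (E y') n = 0" for x x' y y' m
  proof -
    \<comment> \<open>Replacing the cut points by fixed vertices as base points puts the polynomial
      into \<open>F\<close>.\<close>
    have eq: "gap_diff x (D x) x' (D x') y (E y) y' (E y')
        = gd ((snd (a x), D x), (snd (a x'), D x'), (snd (b y), E y), (snd (b y'), E y'))"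
      unfolding gd_def prod.case using that by (intro gap_diff_line_num_cong Dnum Enum)
    moreover have "\<dots> \<in> F" unfolding F_def using that by (intro UnI1 UnI2 imageI SigmaI Dnum Enum)
    ultimately show ?thesis using n(2) that by metis
  qed
  have gen2: "line_num x (D x) m \<bullet> line_num x' (D x') m = 0"
    if "x \<in> X n" "x' \<in> X n" "m \<in> W" "line_num x (D x) n \<bullet> line_num x' (D x') n = 0" for x x' m
  proof -
    have eq: "(\<lambda>m. line_num x (D x) m \<bullet> line_num x' (D x') m) = ip ((snd (a x), D x), (snd (a x'), D x'))"
      unfolding ip_def prod.case using that Dnum(1) by metis
    moreover have "\<dots> \<in> F" unfolding F_def using that by (intro UnI2 imageI SigmaI Dnum)
    ultimately show ?thesis using n(2) that by metis
  qed
  obtain \<sigma> where \<sigma>: "bij_betw \<sigma> (X n) (X' n)"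
    "\<And>x x'. x \<in> X n \<Longrightarrow> x' \<in> X n \<Longrightarrow> norm (\<sigma> x - \<sigma> x') = norm (x - x')"
    using iso[OF nW \<open>n \<noteq> 0\<close>] by blast
  \<comment> \<open>\<open>D\<close> rests on arbitrary choices but agrees up to scaling with every
    crossing pair at the same extreme point; so the given nonparallel pairs transfer to
    \<open>D\<close>.\<close>
  have dir: "span {y - y'} = span {D (line_cut y' (y - y') n)}"
    if "y \<in> V" "y' \<in> V" "y \<bullet> n > 0" "y' \<bullet> n < 0" "line_cut y' (y - y') n \<in> X n" for y y'
    unfolding D_def using a[OF that(5)] that
    by (intro crossing_direction_unique[OF convex_convex_hull[of V], of "line_cut y' (y - y') n" n])
      (auto simp: X_def hull_inc)
  have np: "\<exists>x\<in>X n. \<exists>x'\<in>X n. span {D x} \<noteq> span {D x'}"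
    using nonpar[of n] n(1) dir by (metis IntD1)
  have sub: "X' n \<subseteq> W \<inter> {m. n \<bullet> m = 0}" using XV'(2) span_superset by metis
  have "X' n = X n \<or> X' n = uminus ` X n"
    by (rule transversal_points_congruent[OF W(1) nW XV(1,2) sub XV(3) XV'(3) \<sigma> D E gen1 gen2 np])
  then have "slice (convex hull V') n = slice (convex hull V) n \<or>
      slice (convex hull V') n = uminus ` slice (convex hull V) n"
    unfolding XV(4) XV'(4)
  proof
    assume "X' n = uminus ` X n"
    then have "convex hull X' n = uminus ` (convex hull X n)"
      by (simp add: convex_hull_linear_image linear_uminus)
    then show "convex hull X' n = convex hull X n \<or> convex hull X' n = uminus ` (convex hull X n)" ..
  qed simp
  then show ?thesis using n(1) by blast
qed

section \<open>Hyperplanes that tell two polytopes apart\<close>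

text \<open>Pulling \<open>v\<close> slightly towards 0 keeps it outside \<open>L\<close> and makes
  it interior to \<open>K\<close> relative to \<open>W\<close>. The centre being a multiple of
  \<open>v\<close>, every hyperplane through 0 and \<open>v\<close> contains it.\<close>

lemma ball_in_difference:
  fixes K L :: "'a::euclidean_space set"
  assumes W: "subspace W" and K: "convex K" and L: "closed L" and r: "0 < r" "ball 0 r \<inter> W \<subseteq> K"
    and v: "v \<in> W" "v \<in> K" "v \<notin> L"
  shows "\<exists>c \<epsilon>. \<epsilon> > 0 \<and> ball (c *\<^sub>R v) \<epsilon> \<inter> W \<subseteq> K - L"
proof -
  have "open (- L)" "v \<in> - L" using L v by auto
  then obtain \<delta> where \<delta>: "\<delta> > 0" "ball v \<delta> \<subseteq> - L" by (meson open_contains_ball)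
  \<comment> \<open>This bounds the shift \<open>s *\<^sub>R v\<close> by half of
    \<open>\<delta>\<close>; adding 1 avoids a zero denominator.\<close>
  define s where "s = min (1 / 2) (\<delta> / (2 * (norm v + 1)))"
  have "norm v + 1 > 0" by (simp add: add_nonneg_pos)
  then have "0 < s" "s < 1" "s \<le> \<delta> / 2 / (norm v + 1)"
    using \<delta> by (auto simp: s_def)
  then have s: "0 < s" "s < 1" "s * (norm v + 1) \<le> \<delta> / 2"
    using \<open>norm v + 1 > 0\<close> by (simp_all only: pos_le_divide_eq)
  define \<epsilon> where "\<epsilon> = min (\<delta> / 2) (s * r)"
  have "\<epsilon> > 0" using \<delta> s r by (simp add: \<epsilon>_def)
  moreover have "z \<in> K - L" if z: "z \<in> ball ((1 - s) *\<^sub>R v) \<epsilon>" "z \<in> W" for z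
  proof
    \<comment> \<open>Exhibits \<open>z\<close> as a convex combination of \<open>v\<close> and a
      point \<open>w\<close> of the ball about 0.\<close>
    define w where "w = (1 / s) *\<^sub>R (z - (1 - s) *\<^sub>R v)"
    have zn: "norm (z - (1 - s) *\<^sub>R v) < \<epsilon>" using z by (simp add: dist_norm norm_minus_commute)
    also have "\<dots> \<le> s * r" by (simp add: \<epsilon>_def)
    finally have "norm (z - (1 - s) *\<^sub>R v) / s < r" using s by (simp add: pos_divide_less_eq mult.commute)
    moreover have "norm w = norm (z - (1 - s) *\<^sub>R v) / s" using s by (simp add: w_def)
    ultimately have "norm w < r" by simp
    moreover have "w \<in> W" using z v W by (simp add: w_def subspace_diff subspace_scale)
    ultimately have "w \<in> K" using r by auto
    moreover have "z = (1 - s) *\<^sub>R v + s *\<^sub>R w" using s by (simp add: w_def)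
    ultimately show "z \<in> K" using K v s by (simp add: convex_alt)
    have "norm (z - v) \<le> norm (z - (1 - s) *\<^sub>R v) + norm (s *\<^sub>R v)"
      using norm_triangle_ineq4[of "z - (1 - s) *\<^sub>R v" "s *\<^sub>R v"] by (simp add: algebra_simps)
    moreover have "norm (s *\<^sub>R v) < \<delta> / 2" using s by (simp add: algebra_simps)
    moreover have "\<epsilon> \<le> \<delta> / 2" by (simp add: \<epsilon>_def)
    ultimately have "norm (z - v) < \<delta>" using zn by linarith
    then show "z \<notin> L" using \<delta> by (auto simp: dist_norm norm_minus_commute)
  qed
  ultimately show ?thesis by blast
qed

text \<open>Orthogonal projection to the hyperplane moves \<open>a\<close> by
  \<open>\<bar>a \<bullet> n\<bar> / norm n\<close>.\<close>

lemma hyperplane_meets_ball: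
  fixes a :: "'a::euclidean_space"
  assumes W: "subspace W" "a \<in> W" "n \<in> W" and "\<bar>a \<bullet> n\<bar> < \<epsilon> * norm n"
  shows "\<exists>z\<in>ball a \<epsilon> \<inter> W. n \<bullet> z = 0"
proof
  define z where "z = a - ((a \<bullet> n) / (n \<bullet> n)) *\<^sub>R n"
  have n: "n \<noteq> 0" using assms(4) by auto
  show "n \<bullet> z = 0" using n by (simp add: z_def inner_simps inner_commute)
  have "norm (a - z) = \<bar>a \<bullet> n\<bar> / norm n"
    using n by (simp add: z_def power2_norm_eq_inner[symmetric] power2_eq_square)
  also have "\<dots> < \<epsilon>" using n assms(4) by (simp add: field_simps)
  finally show "z \<in> ball a \<epsilon> \<inter> W"
    using W by (simp add: dist_norm z_def subspace_diff subspace_scale)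
qed

text \<open>By contradiction: one ball centred on the line through 0 and \<open>p\<close> forbids
  equal sections, a second one forbids opposite sections. Some hyperplane meets both and is close
  enough to one through \<open>p\<close> to cut nonparallel edges.\<close>

lemma hulls_opposite_if_vertex_outside:
  fixes V V' W :: "'a::euclidean_space set"
  assumes V: "finite V" "V \<subseteq> W" "\<And>y. y \<in> V \<Longrightarrow> y extreme_point_of (convex hull V)"
    and V': "finite V'" "V' \<subseteq> W" "\<And>y. y \<in> V' \<Longrightarrow> y extreme_point_of (convex hull V')"
    and W: "subspace W" "3 \<le> dim W"
    and r: "0 < r" "ball 0 r \<inter> W \<subseteq> convex hull V" "ball 0 r \<inter> W \<subseteq> convex hull V'"
    and iso: "\<And>n. n \<in> W \<Longrightarrow> n \<noteq> 0 \<Longrightarrow>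
      \<exists>\<sigma>. bij_betw \<sigma> {x. x extreme_point_of slice (convex hull V) n} {x. x extreme_point_of slice (convex hull V') n} \<and>
      (\<forall>x\<in>{x. x extreme_point_of slice (convex hull V) n}.
        \<forall>x'\<in>{x. x extreme_point_of slice (convex hull V) n}. norm (\<sigma> x - \<sigma> x') = norm (x - x'))"
    and p: "p \<in> V" "p \<notin> convex hull V'"
  shows "convex hull V = uminus ` (convex hull V')"
proof (rule ccontr)
  assume neq: "\<not> ?thesis"
  define K where "K = convex hull V"
  define L where "L = convex hull V'"
  have KW: "K \<subseteq> W" "L \<subseteq> W"
    unfolding K_def L_def by (intro hull_minimal V V' subspace_imp_convex W)+
  have K: "convex K" "closed K" "convex L" "closed L"
    using V V' by (auto simp: K_def L_def intro: compact_imp_closed finite_imp_compact_convex_hull)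
  have mL: "convex (uminus ` L)" "closed (uminus ` L)" "ball 0 r \<inter> W \<subseteq> uminus ` L"
  proof -
    show "convex (uminus ` L)" using K by (simp add: convex_negations)
    show "closed (uminus ` L)" using K by (simp add: closed_negations)
    show "ball 0 r \<inter> W \<subseteq> uminus ` L"
    proof
      fix x assume "x \<in> ball 0 r \<inter> W"
      then have "- x \<in> L" using r W by (auto simp: L_def subspace_neg intro!: subsetD[OF r(3)])
      then show "x \<in> uminus ` L" by (metis image_eqI minus_minus)
    qed
  qed
  have p0: "p \<noteq> 0" "p \<in> W" "p \<in> K" "p \<notin> L"
    using p V W(1) r by (auto simp: K_def L_def hull_inc subspace_0 intro!: subsetD[OF r(3)])
  obtain c \<epsilon> where a: "\<epsilon> > 0" "ball (c *\<^sub>R p) \<epsilon> \<inter> W \<subseteq> K - L"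
    using ball_in_difference[OF W(1) K(1,4) r(1) _ p0(2-4)] r by (auto simp: K_def)
  define a where "a = c *\<^sub>R p"
  have aW: "a \<in> W" using p0 W by (simp add: a_def subspace_scale)
  have "\<exists>b\<in>W. \<exists>\<eta>>0. ball b \<eta> \<inter> W \<subseteq> K - uminus ` L \<or> ball b \<eta> \<inter> W \<subseteq> uminus ` L - K"
  proof -
    have "K \<noteq> uminus ` L" using neq by (simp add: K_def L_def)
    then consider v where "v \<in> K" "v \<notin> uminus ` L" | v where "v \<in> uminus ` L" "v \<notin> K" by blast
    then show ?thesis
    proof cases
      case 1
      then have "v \<in> W" using KW by auto
      then show ?thesis
        using ball_in_difference[OF W(1) K(1) mL(2) r(1) _ _ 1] r(2) W(1) subspace_scale
        unfolding K_def by metis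
    next
      case 2
      then have "v \<in> W" using KW W by (auto simp: subspace_neg)
      then show ?thesis
        using ball_in_difference[OF W(1) mL(1) K(2) r(1) mL(3) _ 2] W(1) subspace_scale by metis
    qed
  qed
  then obtain b \<eta> where b: "b \<in> W" "\<eta> > 0"
    "ball b \<eta> \<inter> W \<subseteq> K - uminus ` L \<or> ball b \<eta> \<inter> W \<subseteq> uminus ` L - K" by blast
  \<comment> \<open>Normals of hyperplanes meeting both balls, by
    \<open>hyperplane_meets_ball\<close>.\<close>
  define U where "U = {n. \<bar>a \<bullet> n\<bar> < \<epsilon> * norm n} \<inter> {n. \<bar>b \<bullet> n\<bar> < \<eta> * norm n}"
  have U: "open U" unfolding U_def
    by (intro open_Int open_Collect_less continuous_intros)
  define T where "T = W \<inter> {m. p \<bullet> m = 0}"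
  have T: "subspace T" unfolding T_def
    by (intro subspace_inter W) (simp add: subspace_hyperplane)
  \<comment> \<open>Dimension at least 3 leaves a nonzero normal orthogonal to \<open>p\<close> and
    \<open>b\<close>; it lies in \<open>U\<close>, since \<open>a\<close> is a multiple of
    \<open>p\<close>.\<close>
  have "dim W \<le> dim (T \<inter> {m. b \<bullet> m = 0}) + 2"
    using dim_Int_hyperplane_ge[OF W(1), of p] dim_Int_hyperplane_ge[OF T, of b] unfolding T_def by linarith
  then have "dim (T \<inter> {m. b \<bullet> m = 0}) \<noteq> 0" using W by linarith
  then obtain n1 where n1: "n1 \<in> T" "b \<bullet> n1 = 0" "n1 \<noteq> 0" by (auto simp: dim_eq_0)
  have "n1 \<in> U" using n1 \<open>\<epsilon> > 0\<close> b by (simp add: U_def T_def a_def)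
  then have "U \<inter> T \<noteq> {}" using n1 by auto
  moreover have "finite ((\<lambda>y m. y \<bullet> m) ` {y \<in> V. y \<notin> span {p}})" using V by simp
  \<comment> \<open>Genericity within \<open>T\<close> gives a hyperplane through \<open>p\<close>
    that avoids all vertices off the line through 0 and \<open>p\<close>.\<close>
  ultimately have "\<exists>n\<in>U \<inter> T. \<forall>f\<in>(\<lambda>y m. y \<bullet> m) ` {y \<in> V. y \<notin> span {p}}. f n = 0 \<longrightarrow> (\<forall>m\<in>T. f m = 0)"
    using T U by (intro generic_point) auto
  then obtain n0 where n0: "n0 \<in> U" "n0 \<in> T"
    "\<And>y. y \<in> V \<Longrightarrow> y \<notin> span {p} \<Longrightarrow> y \<bullet> n0 = 0 \<Longrightarrow> \<forall>m\<in>T. y \<bullet> m = 0" by auto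
  have off: "y \<in> span {p}" if y: "y \<in> V" "y \<bullet> n0 = 0" for y
  proof (rule ccontr)
    assume "y \<notin> span {p}"
    then have "\<exists>m\<in>W. p \<bullet> m = 0 \<and> (\<forall>u\<in>{y}. u \<bullet> m \<noteq> 0)"
      using V y p0 by (intro generic_orthogonal W) auto
    then show False using n0(3)[OF y(1) \<open>y \<notin> span {p}\<close> y(2)] by (auto simp: T_def)
  qed
  have n0W: "n0 \<in> W" "p \<bullet> n0 = 0" using n0 by (auto simp: T_def)
  have "n0 \<noteq> 0" using n0(1) by (auto simp: U_def)
  have dim: "2 \<le> dim (W \<inter> {m. n0 \<bullet> m = 0})"
    using dim_Int_hyperplane_ge[OF W(1), of n0] W by linarith
  define np where "np = (\<lambda>n. \<exists>y\<in>V. \<exists>y'\<in>V. \<exists>z\<in>V. \<exists>z'\<in>V.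
      y \<bullet> n > 0 \<and> y' \<bullet> n < 0 \<and> z \<bullet> n > 0 \<and> z' \<bullet> n < 0 \<and>
      line_cut y' (y - y') n extreme_point_of slice (convex hull V) n \<and>
      line_cut z' (z - z') n extreme_point_of slice (convex hull V) n \<and>
      span {y - y'} \<noteq> span {z - z'})"
  have "\<exists>s\<in>{1, -1}. \<forall>\<^sub>F n in nhds n0. s * (p \<bullet> n) > 0 \<longrightarrow> np n"
    unfolding np_def
    by (rule nonparallel_edges_near_vertex[OF V(1) V(3) W(1) r(1,2) p(1) n0W(2,1) \<open>n0 \<noteq> 0\<close> dim off])
  then obtain s N where s: "s \<in> {1, -1 :: real}"
    and N: "open N" "n0 \<in> N" "\<And>n. n \<in> N \<Longrightarrow> s * (p \<bullet> n) > 0 \<Longrightarrow> np n"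
    unfolding eventually_nhds by blast
  \<comment> \<open>Tilting \<open>n0\<close> slightly so that \<open>p\<close> falls on the side
    \<open>s\<close> still meets both balls and makes nonparallel edges available.\<close>
  define U2 where "U2 = U \<inter> N \<inter> {n. 0 < s * (p \<bullet> n)}"
  have U2: "open U2" unfolding U2_def
    by (intro open_Int U N open_Collect_less continuous_intros)
  have "U2 \<inter> W \<noteq> {}"
  proof -
    have "open (U \<inter> N)" "n0 \<in> U \<inter> N" using U N n0 by auto
    then obtain \<delta> where \<delta>: "\<delta> > 0" "ball n0 \<delta> \<subseteq> U \<inter> N" by (meson open_contains_ball)
    define h where "h = n0 + (s * (\<delta> / (2 * norm p))) *\<^sub>R p"
    have "dist n0 h = \<delta> / 2" using p0 s \<delta> by (auto simp: h_def dist_norm)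
    then have "h \<in> U \<inter> N" using \<delta> by auto
    moreover have "s * (p \<bullet> h) > 0"
      using s p0 n0W \<delta> by (auto simp: h_def inner_simps)
    moreover have "h \<in> W" using n0W p0 W by (simp add: h_def subspace_add subspace_scale)
    ultimately show ?thesis by (auto simp: U2_def)
  qed
  have zV: "0 \<notin> V" "0 \<notin> V'"
    using V(3) V'(3) zero_not_extreme_point[OF W(1) n0W(1) \<open>n0 \<noteq> 0\<close> r(1)] r(2,3) by blast+
  have "\<exists>n\<in>U2 \<inter> W. slice (convex hull V') n = slice (convex hull V) n \<or>
    slice (convex hull V') n = uminus ` slice (convex hull V) n"
  proof (rule generic_congruent_slices[OF V(1,2) zV(1) V'(1,2) zV(2) W r U2 \<open>U2 \<inter> W \<noteq> {}\<close>])
    fix n assume "n \<in> W" "n \<noteq> 0"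
    then show "\<exists>\<sigma>. bij_betw \<sigma> {x. x extreme_point_of slice (convex hull V) n} {x. x extreme_point_of slice (convex hull V') n} \<and>
      (\<forall>x\<in>{x. x extreme_point_of slice (convex hull V) n}.
        \<forall>x'\<in>{x. x extreme_point_of slice (convex hull V) n}. norm (\<sigma> x - \<sigma> x') = norm (x - x'))"
      by (rule iso)
  next
    fix n assume "n \<in> U2"
    then have "n \<in> N" "s * (p \<bullet> n) > 0" by (auto simp: U2_def)
    from N(3)[OF this] show "\<exists>y\<in>V. \<exists>y'\<in>V. \<exists>z\<in>V. \<exists>z'\<in>V. y \<bullet> n > 0 \<and> y' \<bullet> n < 0 \<and> z \<bullet> n > 0 \<and> z' \<bullet> n < 0 \<and>
      line_cut y' (y - y') n \<in> {x. x extreme_point_of slice (convex hull V) n} \<and>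
      line_cut z' (z - z') n \<in> {x. x extreme_point_of slice (convex hull V) n} \<and> span {y - y'} \<noteq> span {z - z'}"
      unfolding np_def by simp
  qed
  then obtain n where n: "n \<in> U" "n \<in> W" "slice L n = slice K n \<or> slice L n = uminus ` slice K n"
    by (auto simp: U2_def K_def L_def)
  obtain z where z: "z \<in> ball a \<epsilon> \<inter> W" "n \<bullet> z = 0"
    using hyperplane_meets_ball[OF W(1) aW n(2), of \<epsilon>] n(1) unfolding U_def by blast
  then have "z \<in> slice K n" "z \<notin> slice L n" using \<open>ball (c *\<^sub>R p) \<epsilon> \<inter> W \<subseteq> K - L\<close> by (auto simp: slice_def a_def)
  then have opp: "slice L n = uminus ` slice K n" using n by blast
  obtain z' where z': "z' \<in> ball b \<eta> \<inter> W" "n \<bullet> z' = 0"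
    using hyperplane_meets_ball[OF W(1) b(1) n(2), of \<eta>] n(1) unfolding U_def by blast
  have "z' \<in> K \<longleftrightarrow> z' \<in> slice K n" using z' by (simp add: slice_def)
  also have "\<dots> \<longleftrightarrow> - z' \<in> slice L n" unfolding opp by force
  also have "\<dots> \<longleftrightarrow> - z' \<in> L" using z' by (simp add: slice_def)
  also have "\<dots> \<longleftrightarrow> z' \<in> uminus ` L" by force
  finally show False using b(3) z' by blast
qed

section \<open>Reduction to subspaces of dimension k + 1\<close>

lemma polytope_extreme_points:
  fixes P :: "'a::euclidean_space set"
  assumes "polytope P"
  shows "finite {x. x extreme_point_of P}" "convex hull {x. x extreme_point_of P} = P"
  using assms finite_polyhedron_extreme_points[of P] Krein_Milman_Minkowski[of P]
  by (auto simp: polytope_imp_polyhedron polytope_imp_compact polytope_imp_convex)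

lemma polytopes_opposite_if_vertex_outside:
  fixes P Q :: "'a::euclidean_space set"
  assumes k: "2 \<le> k" "k + 1 \<le> DIM('a)" and P: "polytope P" "0 \<in> interior P" and Q: "polytope Q" "0 \<in> interior Q"
    and iso: "\<And>H :: 'a set. subspace H \<Longrightarrow> dim H = k \<Longrightarrow>
      \<exists>\<sigma>. bij_betw \<sigma> {x. x extreme_point_of (P \<inter> H)} {x. x extreme_point_of (Q \<inter> H)} \<and>
      (\<forall>x\<in>{x. x extreme_point_of (P \<inter> H)}. \<forall>x'\<in>{x. x extreme_point_of (P \<inter> H)}.
        norm (\<sigma> x - \<sigma> x') = norm (x - x'))"
    and p: "p extreme_point_of P" "p \<notin> Q"
  shows "P = uminus ` Q"
proof -
  have "v \<in> P \<longleftrightarrow> v \<in> uminus ` Q" for v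
  proof -
    obtain B0 where B0: "B0 \<subseteq> {p, v}" "independent B0" "{p, v} \<subseteq> span B0" "card B0 = dim {p, v}"
      using basis_exists[of "{p, v}"] by blast
    obtain B1 where B1: "B0 \<subseteq> B1" "B1 \<subseteq> UNIV" "independent B1" "UNIV \<subseteq> span B1"
      by (rule maximal_independent_subset_extend[OF subset_UNIV B0(2)])
    have "dim {p, v} \<le> card {p, v}" by (rule dim_le_card') simp
    also have "\<dots> \<le> 2" by (simp add: card_insert_if)
    finally have "card B0 \<le> k + 1" using B0(4) k by linarith
    moreover have "card B1 = DIM('a)" using B1(2-4) by (metis dim_UNIV basis_card_eq_dim)
    moreover have "finite B1" using B1(3) by (rule independent_imp_finite)
    \<comment> \<open>A basis of the span of \<open>{p, v}\<close> is enlarged within a basis of the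
      whole space to exactly \<open>k + 1\<close> vectors; this also covers dependent
      \<open>p\<close> and \<open>v\<close>.\<close>
    ultimately obtain B where B: "B0 \<subseteq> B" "B \<subseteq> B1" "card B = k + 1"
      using exists_subset_between[of B0 "k + 1" B1] k B1(1) by auto
    define W where "W = span B"
    have W: "subspace W" "dim W = k + 1"
      using B independent_mono[OF B1(3) B(2)] by (simp_all add: W_def dim_eq_card_independent)
    have pv: "p \<in> W" "v \<in> W"
    proof -
      have "{p, v} \<subseteq> span B0" by (rule B0(3))
      also have "\<dots> \<subseteq> W" unfolding W_def using B by (intro span_mono)
      finally show "p \<in> W" "v \<in> W" by auto
    qed
    have W3: "3 \<le> dim W" using W k by simp
    have poly: "polytope (P \<inter> W)" "polytope (Q \<inter> W)"
      using P Q W by (auto intro!: polytope_Int_polyhedron affine_imp_polyhedron subspace_imp_affine)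
    define V where "V = {x. x extreme_point_of (P \<inter> W)}"
    define V' where "V' = {x. x extreme_point_of (Q \<inter> W)}"
    note V = polytope_extreme_points[OF poly(1), folded V_def]
    note V' = polytope_extreme_points[OF poly(2), folded V'_def]
    obtain r1 where r1: "r1 > 0" "ball 0 r1 \<subseteq> P" using P by (meson mem_interior)
    obtain r2 where r2: "r2 > 0" "ball 0 r2 \<subseteq> Q" using Q by (meson mem_interior)
    define r where "r = min r1 r2"
    have r: "0 < r" "ball 0 r \<inter> W \<subseteq> convex hull V" "ball 0 r \<inter> W \<subseteq> convex hull V'"
      using r1 r2 by (auto simp: r_def V V')
    have "convex hull V = uminus ` (convex hull V')"
    proof (rule hulls_opposite_if_vertex_outside[of V W V' r p])
      show "\<exists>\<sigma>. bij_betw \<sigma> {x. x extreme_point_of slice (convex hull V) n}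
            {x. x extreme_point_of slice (convex hull V') n} \<and>
          (\<forall>x\<in>{x. x extreme_point_of slice (convex hull V) n}.
              \<forall>x'\<in>{x. x extreme_point_of slice (convex hull V) n}. norm (\<sigma> x - \<sigma> x') = norm (x - x'))"
        if n: "n \<in> W" "n \<noteq> 0" for n
      proof -
        define H where "H = W \<inter> {m. n \<bullet> m = 0}"
        have H: "subspace H" unfolding H_def
          by (intro subspace_inter W) (simp add: subspace_hyperplane)
        have "n \<in> W" "n \<notin> H" "H \<subseteq> W" using n by (auto simp: H_def)
        then have "H \<subset> W" by blast
        moreover have "span H = H" "span W = W" using H W(1) by (simp_all only: span_eq_iff)
        ultimately have "span H \<subset> span W" by (simp only:)
        then have "dim H < dim W" by (rule dim_psubset)
        moreover have "dim W \<le> dim H + 1" unfolding H_def using dim_Int_hyperplane_ge W(1) .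
        ultimately have "dim H = k" using W by simp
        moreover have "slice (convex hull V) n = P \<inter> H" "slice (convex hull V') n = Q \<inter> H"
          by (auto simp: slice_def V V' H_def)
        ultimately show ?thesis using iso[OF H] by simp
      qed
      show "p \<in> V" using p pv by (auto simp: V_def extreme_point_of_def)
      show "p \<notin> convex hull V'" using p by (simp add: V')
    qed (use V V' W W3 r in \<open>auto simp: V_def V'_def extreme_point_of_def\<close>)
    then have "P \<inter> W = uminus ` (Q \<inter> W)" by (simp add: V V')
    moreover have "v \<in> uminus ` S \<longleftrightarrow> - v \<in> S" for S by force
    moreover have "- v \<in> W" using pv W(1) by (simp add: subspace_neg)
    ultimately show ?thesis using pv by blast
  qed
  then show ?thesis by blast
qed

theorem theorem2:
  fixes k d :: nat and P Q :: "'a::euclidean_space set"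
  assumes "DIM('a) = d" and "2 \<le> k" and "k \<le> d - 1"
    and "convex_polytope P" and "convex_polytope Q"
    and "0 \<in> interior P" and "0 \<in> interior Q"
    and "\<And>H :: 'a set. subspace H \<Longrightarrow> dim H = k \<Longrightarrow> congruent_in H (P \<inter> H) (Q \<inter> H)"
  shows "P = Q \<or> P = uminus ` Q"
proof -
  have PQ: "polytope P" "polytope Q" using assms by (simp_all add: convex_polytope_def)
  have k: "2 \<le> k" "k + 1 \<le> DIM('a)" using assms by auto
  have iso: "\<exists>\<sigma>. bij_betw \<sigma> {x. x extreme_point_of (P \<inter> H)} {x. x extreme_point_of (Q \<inter> H)} \<and>
      (\<forall>x\<in>{x. x extreme_point_of (P \<inter> H)}. \<forall>x'\<in>{x. x extreme_point_of (P \<inter> H)}.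
        norm (\<sigma> x - \<sigma> x') = norm (x - x'))"
    if "subspace H" "dim H = k" for H
    using that PQ assms(8)[OF that]
    by (intro congruent_in_extreme_points convex_Int polytope_imp_convex subspace_imp_convex) auto
  \<comment> \<open>The inverse bijection gives the hypothesis with \<open>P\<close> and
    \<open>Q\<close> exchanged, for the case that the outlying vertex belongs to
    \<open>Q\<close>.\<close>
  have iso': "\<exists>\<sigma>. bij_betw \<sigma> {x. x extreme_point_of (Q \<inter> H)} {x. x extreme_point_of (P \<inter> H)} \<and>
      (\<forall>x\<in>{x. x extreme_point_of (Q \<inter> H)}. \<forall>x'\<in>{x. x extreme_point_of (Q \<inter> H)}.
        norm (\<sigma> x - \<sigma> x') = norm (x - x'))"
    if H: "subspace H" "dim H = k" for H
  proof -
    obtain \<sigma> where \<sigma>: "bij_betw \<sigma> {x. x extreme_point_of (P \<inter> H)} {x. x extreme_point_of (Q \<inter> H)}"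
      "\<And>x x'. x extreme_point_of (P \<inter> H) \<Longrightarrow> x' extreme_point_of (P \<inter> H) \<Longrightarrow>
        norm (\<sigma> x - \<sigma> x') = norm (x - x')"
      using iso[OF H] by blast
    define \<tau> where "\<tau> = inv_into {x. x extreme_point_of (P \<inter> H)} \<sigma>"
    have \<tau>: "\<tau> y extreme_point_of (P \<inter> H)" "\<sigma> (\<tau> y) = y" if "y extreme_point_of (Q \<inter> H)" for y
    proof -
      have "y \<in> \<sigma> ` {x. x extreme_point_of (P \<inter> H)}" using that \<sigma>(1) by (simp add: bij_betw_def)
      from inv_into_into[OF this] f_inv_into_f[OF this]
      show "\<tau> y extreme_point_of (P \<inter> H)" "\<sigma> (\<tau> y) = y" by (simp_all add: \<tau>_def)
    qed
    have "norm (\<tau> y - \<tau> y') = norm (y - y')"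
      if "y extreme_point_of (Q \<inter> H)" "y' extreme_point_of (Q \<inter> H)" for y y'
      using \<sigma>(2)[OF \<tau>(1)[OF that(1)] \<tau>(1)[OF that(2)]] \<tau>(2) that by simp
    moreover have "bij_betw \<tau> {x. x extreme_point_of (Q \<inter> H)} {x. x extreme_point_of (P \<inter> H)}"
      unfolding \<tau>_def using \<sigma>(1) by (rule bij_betw_inv_into)
    ultimately show ?thesis by blast
  qed
  have hull: "convex hull {x. x extreme_point_of P} = P" "convex hull {x. x extreme_point_of Q} = Q"
    using PQ polytope_extreme_points by blast+
  have convex: "convex P" "convex Q" using PQ polytope_imp_convex by auto
  show ?thesis
  \<comment> \<open>If neither polytope has a vertex outside the other, taking hulls gives both
    inclusions.\<close>
  proof (cases "{x. x extreme_point_of P} \<subseteq> Q \<and> {x. x extreme_point_of Q} \<subseteq> P")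
    case True
    then have "P \<subseteq> Q" "Q \<subseteq> P"
      using hull convex hull_minimal[of "{x. x extreme_point_of P}" Q convex]
        hull_minimal[of "{x. x extreme_point_of Q}" P convex] by simp_all
    then show ?thesis by blast
  next
    case False
    then consider p where "p extreme_point_of P" "p \<notin> Q" | p where "p extreme_point_of Q" "p \<notin> P" by blast
    then show ?thesis
    proof cases
      case 1
      have "P = uminus ` Q"
        by (rule polytopes_opposite_if_vertex_outside[OF k PQ(1) assms(6) PQ(2) assms(7) _ 1]) (rule iso)
      then show ?thesis by blast
    next
      case 2
      have "Q = uminus ` P"
        by (rule polytopes_opposite_if_vertex_outside[OF k PQ(2) assms(7) PQ(1) assms(6) _ 2]) (rule iso')
      then show ?thesis by (simp add: image_image)
    qed
  qed
qed

end
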